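(* Let $p,q\in\mathbb{N}$ with $p<q$, and let $g\colon(0,\infty)\to\mathbb{R}$ be an infinitely differentiable function. Suppose that $g^{(p)}$ eventually tends monotonically to zero, and that $g^{(q)}$ is regularly monotone on $(0,\infty)$. Then the function $\Sigma g$ exists and is infinitely differentiable on $(0,\infty)$. Moreover, the following assertions hold: (a) $(\Sigma g)^{(n)}$ eventually tends monotonically to zero for every integer $n\geq p+1$. (b) Either both $g^{(q-1)}$ and $(\Sigma g)^{(q)}$ are completely monotone on $(0,\infty)$, or both $-g^{(q-1)}$ and $-(\Sigma g)^{(q)}$ are completely monotone on $(0,\infty)$. Consequently, $\Sigma g$ is real analytic on $(0,\infty)$ and admits a Newton series expansion on $(0,\infty)$ at every point $a>0$.
   Context: $\mathbb{N}$ denotes the set of nonnegative integers. $\Delta$ is the forward difference operator, $\Delta f(x)=f(x+1)-f(x)$, and $\Delta^k$ its $k$th iterate ($\Delta^0f=f$). For $z\in\mathbb{R}$ and $k\in\mathbb{N}$, $\binom{z}{k}=\frac{z(z-1)\cdots(z-k+1)}{k!}$ (equal to $1$ when $k=0$). A function $h\colon I\to\mathbb{R}$ on an open interval $I$ is completely monotone if it is infinitely differentiable and $(-1)^n h^{(n)}(x)\geq 0$ for all $x\in I$ and $n\in\mathbb{N}$. It is regularly monotone if it is infinitely differentiable and each derivative $h^{(n)}$, $n\in\mathbb{N}$ (including $h^{(0)}=h$), has a constant sign on $I$ (i.e., for each $n$, either $h^{(n)}\geq 0$ on $I$ or $h^{(n)}\leq 0$ on $I$), with no restriction on the distribution of these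 signs. A function $h\colon(0,\infty)\to\mathbb{R}$ eventually tends monotonically to zero if $h(x)\to 0$ as $x\to\infty$ and $h$ is monotone (in the weak sense: nondecreasing or nonincreasing) on some right-unbounded subinterval of $(0,\infty)$. A function $f\colon I\to\mathbb{R}$ on a right-unbounded open interval $I$ admits a Newton series expansion on $I$ at $a\in I$ if $f(x)=\sum_{k=0}^{\infty}\binom{x-a}{k}\Delta^k f(a)$ for all $x\in I$. For an integer $r\geq -1$, a function $f$ on an interval $J$ is $r$-convex (resp. $r$-concave) on $J$ if for all $x_0<x_1<\cdots<x_{r+1}$ in $J$ the divided difference $f[x_0,\ldots,x_{r+1}]$ (the coefficient of $x^{r+1}$ in the interpolating polynomial of $f$ at these $r+2$ points) is $\geq 0$ (resp. $\leq 0$). $\mathcal{K}^r$ denotes the set of functions $f\colon(0,\infty)\to\mathbb{R}$ that are $r$-convex or $r$-concave on some right-unbounded subinterval of $(0,\infty)$. For $r\in\mathbb{N}$, $\mathcal{D}^r$ denotes the set of functions $g\colon(0,\infty)\to\mathbb{R}$ such that $\Delta^r g(n)\to 0$ as $n\to\infty$ over positive integers $n$. Definition of $\Sigma$: it is known that if $g\in\mathcal{D}^r\cap\mathcal{K}^r$ for some $r\in\mathbb{N}$, then there is a unique $f\in\mathcal{K}^r$ with $f(1)=0$ and $\Delta f=g$ on $(0,\infty)$; it is given by $$f(x)=\lim_{n\to\infty}\Big(\sum_{k=1}^{n-1}g(k)-\sum_{k=0}^{n-1}g(x+k)+\sum_{j=1}^r\binom{x}{j}\Delta^{j-1}g(n)\Big)\qquad(x>0),$$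 and it does not depend on the choice of such an $r$. This $f$ is denoted $\Sigma g$. One says that $\Sigma g$ exists if $g\in\mathcal{D}^r\cap\mathcal{K}^r$ for some $r\in\mathbb{N}$. *)

theory Defs
  imports "HOL-Analysis.Analysis" "HOL-Computational_Algebra.Polynomial"
begin

text \<open>A function on an open interval is a total function of type \<^typ>\<open>real \<Rightarrow> real\<close> whose values
  off the interval play no role. The \<open>n\<close>th derivative is \<open>(deriv ^^ n) f\<close>; on an open set it
  depends only on the values of \<open>f\<close> there, and it is meaningful there as soon as
  \<open>infinitely_differentiable_on\<close> holds.\<close>

definition infinitely_differentiable_on :: "(real \<Rightarrow> real) \<Rightarrow> real set \<Rightarrow> bool" where
  "infinitely_differentiable_on h I \<longleftrightarrow>
     (\<forall>n. \<forall>x\<in>I. (deriv ^^ n) h field_differentiable (at x))"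

definition completely_monotone_on :: "(real \<Rightarrow> real) \<Rightarrow> real set \<Rightarrow> bool" where
  "completely_monotone_on h I \<longleftrightarrow>
     infinitely_differentiable_on h I \<and> (\<forall>n. \<forall>x\<in>I. 0 \<le> (-1) ^ n * (deriv ^^ n) h x)"

definition regularly_monotone_on :: "(real \<Rightarrow> real) \<Rightarrow> real set \<Rightarrow> bool" where
  "regularly_monotone_on h I \<longleftrightarrow>
     infinitely_differentiable_on h I \<and>
     (\<forall>n. (\<forall>x\<in>I. 0 \<le> (deriv ^^ n) h x) \<or> (\<forall>x\<in>I. (deriv ^^ n) h x \<le> 0))"

definition real_analytic_on :: "(real \<Rightarrow> real) \<Rightarrow> real set \<Rightarrow> bool" where
  "real_analytic_on f I \<longleftrightarrow>
     (\<forall>a\<in>I. \<exists>c :: nat \<Rightarrow> real. \<exists>\<rho>>0. \<forall>x\<in>I. \<bar>x - a\<bar> < \<rho> \<longrightarrow> (\<lambda>n. c n * (x - a) ^ n) sums f x)"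

definition right_unbounded_subinterval :: "real set \<Rightarrow> bool" where
  "right_unbounded_subinterval J \<longleftrightarrow> is_interval J \<and> J \<subseteq> {0<..} \<and> \<not> bdd_above J"

definition eventually_tends_monotonically_to_zero :: "(real \<Rightarrow> real) \<Rightarrow> bool" where
  "eventually_tends_monotonically_to_zero h \<longleftrightarrow>
     (h \<longlongrightarrow> 0) at_top \<and>
     (\<exists>J. right_unbounded_subinterval J \<and> (mono_on J h \<or> antimono_on J h))"

definition fdiff :: "(real \<Rightarrow> real) \<Rightarrow> real \<Rightarrow> real" where
  "fdiff f = (\<lambda>x. f (x + 1) - f x)"

definition admits_newton_series :: "(real \<Rightarrow> real) \<Rightarrow> real set \<Rightarrow> real \<Rightarrow> bool" where
  "admits_newton_series f I a \<longleftrightarrow>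
     (\<forall>x\<in>I. (\<lambda>k. ((x - a) gchoose k) * (fdiff ^^ k) f a) sums f x)"

text \<open>\<open>divided_difference f x m\<close> is \<open>f[x 0, \<dots>, x m]\<close>, for pairwise distinct nodes
  \<open>x 0, \<dots>, x m\<close>; only then is the interpolating polynomial unique.\<close>

definition interpolating_poly :: "(real \<Rightarrow> real) \<Rightarrow> (nat \<Rightarrow> real) \<Rightarrow> nat \<Rightarrow> real poly" where
  "interpolating_poly f x m = (THE P. degree P \<le> m \<and> (\<forall>i\<le>m. poly P (x i) = f (x i)))"

definition divided_difference :: "(real \<Rightarrow> real) \<Rightarrow> (nat \<Rightarrow> real) \<Rightarrow> nat \<Rightarrow> real" where
  "divided_difference f x m = coeff (interpolating_poly f x m) m"

text \<open>Higher-order convexity also makes sense for \<open>r = -1\<close>; only \<open>r \<ge> 0\<close> is used below.\<close>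

definition r_convex_on :: "nat \<Rightarrow> real set \<Rightarrow> (real \<Rightarrow> real) \<Rightarrow> bool" where
  "r_convex_on r J f \<longleftrightarrow>
     (\<forall>x. strict_mono_on {..r + 1} x \<and> x ` {..r + 1} \<subseteq> J \<longrightarrow> 0 \<le> divided_difference f x (r + 1))"

definition r_concave_on :: "nat \<Rightarrow> real set \<Rightarrow> (real \<Rightarrow> real) \<Rightarrow> bool" where
  "r_concave_on r J f \<longleftrightarrow>
     (\<forall>x. strict_mono_on {..r + 1} x \<and> x ` {..r + 1} \<subseteq> J \<longrightarrow> divided_difference f x (r + 1) \<le> 0)"

definition K_class :: "nat \<Rightarrow> (real \<Rightarrow> real) set" where
  "K_class r = {f. \<exists>J. right_unbounded_subinterval J \<and> (r_convex_on r J f \<or> r_concave_on r J f)}"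

definition D_class :: "nat \<Rightarrow> (real \<Rightarrow> real) set" where
  "D_class r = {g. (\<lambda>n. (fdiff ^^ r) g (real n)) \<longlonglongrightarrow> 0}"

definition Sigma_exists :: "(real \<Rightarrow> real) \<Rightarrow> bool" where
  "Sigma_exists g \<longleftrightarrow> (\<exists>r. g \<in> D_class r \<inter> K_class r)"

text \<open>The solution is unique as a function on the positive half-line;
  membership in \<open>extensional {0<..}\<close> fixes the irrelevant values elsewhere.
  Since the solution is the same for every admissible \<open>r\<close>, the \<open>r\<close> may be quantified inside.\<close>

definition Sigma_fun :: "(real \<Rightarrow> real) \<Rightarrow> real \<Rightarrow> real" where
  "Sigma_fun g = (THE f. f \<in> extensional {0<..} \<and>
     (\<exists>r. g \<in> D_class r \<inter> K_class r \<and> f \<in> K_class r) \<and>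
     f 1 = 0 \<and> (\<forall>x>0. fdiff f x = g x))"

end

theory Submission
  imports Defs
begin

text \<open>Monotonicity propagates the limit \<open>0\<close> from \<open>g\<^sup>(\<^sup>p\<^sup>)\<close> to all higher derivatives, and a function
  tending to \<open>0\<close> whose derivative has constant sign has the opposite sign; hence \<open>g\<^sup>(\<^sup>q\<^sup>-\<^sup>1\<^sup>)\<close> is
  completely monotone up to a sign. Then \<open>- \<Sum>k. g\<^sup>(\<^sup>q\<^sup>) (x + k)\<close> converges with all its derivatives, by
  telescoping domination, and integrating it \<open>q\<close> times with suitable constants gives a solution \<open>f\<close>
  of \<open>\<Delta>f = g\<close> in the class \<open>K\<^sup>q\<^sup>-\<^sup>1\<close>. Interpolating at \<open>n, \<dots>, n + r\<close> and letting \<open>n\<close> grow shows that such a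
  solution is determined by \<open>g\<close>. The alternating signs of the derivatives of \<open>f\<close> of order at least
  \<open>q\<close> control the remainders of its Taylor and Newton series.\<close>

section \<open>Divided differences and the Newton formula\<close>

text \<open>The sum is formed at order q because the values of g^(q-1) at x, x + 1, ... need not be
  summable (as for 1/x), whereas those of its derivative are dominated by the drops of g^(q-1) over
  unit intervals. The way back to order 0 is delicate, since every integration leaves an unknown
  constant in the difference equation. At the first integration no correction is allowed: a linear
  term would shift the derivative of order q and spoil its sign and limit. There the constant
  vanishes by itself, because both sides of the equation tend to 0. All later corrections touch only
  derivatives of order below q. Hence the construction says nothing about the limits of the
  derivatives of orders p + 1, ..., q - 1. Assertion (a) comes instead from \<open>\<Delta>\<close>
  f^(p) = g^(p) tending to 0, combined with eventual signs at every order. \<open>Sigma_fun\<close>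
  quantifies r inside its description, so a competing solution may belong to another convexity
  class; uniqueness therefore has to compare two classes at a common interpolation order.\<close>

definition dd :: "(real \<Rightarrow> real) \<Rightarrow> real set \<Rightarrow> real" where
  "dd f X = (\<Sum>y\<in>X. f y / (\<Prod>z\<in>X - {y}. y - z))"

lemma dd_singleton [simp]: "dd f {a} = f a"
  by (simp add: dd_def)

lemma dd_cmult: "dd (\<lambda>x. c * f x) X = c * dd f X"
  by (simp add: dd_def sum_distrib_left)

lemma dd_insert:
  assumes "finite X" "a \<notin> X"
  shows "dd f (insert a X) = f a / (\<Prod>z\<in>X. a - z) + (\<Sum>y\<in>X. f y / ((y - a) * (\<Prod>z\<in>X - {y}. y - z)))"
proof -
  have "(\<Prod>z\<in>insert a X - {y}. y - z) = (y - a) * (\<Prod>z\<in>X - {y}. y - z)" if "y \<in> X" for y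
  proof -
    have "insert a X - {y} = insert a (X - {y})" using that assms by auto
    then show ?thesis using assms by simp
  qed
  moreover have "insert a X - {a} = X" using assms by auto
  ultimately show ?thesis
    unfolding dd_def using assms by (simp cong: sum.cong)
qed

text \<open>Termwise this is the partial fraction identity
  \<open>(u - v) / ((y - u) * (y - v)) = 1 / (y - u) - 1 / (y - v)\<close>. As \<open>dd\<close>
  depends only on the node set, \<open>u\<close> and \<open>v\<close> can be any two nodes; later
  arguments choose the pair whose exchange is to be estimated.\<close>

lemma dd_recursion:
  assumes X: "finite X" and uv: "u \<notin> X" "v \<notin> X" "u \<noteq> v"
  shows "(u - v) * dd f (insert u (insert v X)) = dd f (insert u X) - dd f (insert v X)"
proof -
  define P where "P y = (\<Prod>z\<in>X - {y}. y - z)" for y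
  have nz: "(\<Prod>z\<in>X. u - z) \<noteq> 0" "(\<Prod>z\<in>X. v - z) \<noteq> 0"
    using X uv by auto
  have PP: "(\<Prod>z\<in>insert v X - {y}. y - z) = (y - v) * P y" if "y \<in> X" for y
  proof -
    have "insert v X - {y} = insert v (X - {y})" using that uv by auto
    then show ?thesis using X uv by (simp add: P_def)
  qed
  have vX: "insert v X - {v} = X" using uv by auto
  have "dd f (insert u (insert v X)) = f u / ((u - v) * (\<Prod>z\<in>X. u - z))
     + (f v / ((v - u) * (\<Prod>z\<in>X. v - z)) + (\<Sum>y\<in>X. f y / ((y - u) * ((y - v) * P y))))"
    using X uv by (simp add: dd_insert PP vX cong: sum.cong)
  then have "(u - v) * dd f (insert u (insert v X)) =
     (u - v) * (f u / ((u - v) * (\<Prod>z\<in>X. u - z)))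
     + (u - v) * (f v / ((v - u) * (\<Prod>z\<in>X. v - z))) 
     + (\<Sum>y\<in>X. (u - v) * (f y / ((y - u) * ((y - v) * P y))))"
    by (simp add: distrib_left sum_distrib_left)
  also have "(u - v) * (f u / ((u - v) * (\<Prod>z\<in>X. u - z))) = f u / (\<Prod>z\<in>X. u - z)"
    using uv by simp
  also have "(u - v) * (f v / ((v - u) * (\<Prod>z\<in>X. v - z))) = - (f v / (\<Prod>z\<in>X. v - z))"
    using uv nz by (simp add: field_simps)
  also have "(\<Sum>y\<in>X. (u - v) * (f y / ((y - u) * ((y - v) * P y))))
      = (\<Sum>y\<in>X. f y / ((y - u) * P y) - f y / ((y - v) * P y))"
  proof (rule sum.cong[OF refl])
    fix y assume "y \<in> X"
    then have "y \<noteq> u" "y \<noteq> v" "P y \<noteq> 0" using X uv by (auto simp: P_def)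
    then show "(u - v) * (f y / ((y - u) * ((y - v) * P y))) = f y / ((y - u) * P y) - f y / ((y - v) * P y)"
      by (simp add: divide_simps) (simp add: algebra_simps)
  qed
  also have "f u / (\<Prod>z\<in>X. u - z) + - (f v / (\<Prod>z\<in>X. v - z)) + \<dots> = dd f (insert u X) - dd f (insert v X)"
    using X uv by (simp add: dd_insert P_def sum_subtractf)
  finally show ?thesis .
qed

section \<open>Lagrange interpolation and higher-order convexity\<close>

definition lagrange_poly :: "(real \<Rightarrow> real) \<Rightarrow> real set \<Rightarrow> real poly" where
  "lagrange_poly f X = (\<Sum>y\<in>X. smult (f y / (\<Prod>z\<in>X - {y}. y - z)) (\<Prod>z\<in>X - {y}. [:- z, 1:]))"

lemma degree_prod_linear: "degree (\<Prod>z\<in>X. [:- z, 1::real:]) = card X"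
proof (cases "finite X")
  case True
  then show ?thesis by (subst degree_prod_eq_sum_degree) auto
qed simp

lemma poly_lagrange:
  assumes "finite X" "y \<in> X"
  shows "poly (lagrange_poly f X) y = f y"
proof -
  have "poly (lagrange_poly f X) y = (\<Sum>w\<in>X. f w / (\<Prod>z\<in>X - {w}. w - z) * (\<Prod>z\<in>X - {w}. y - z))"
    by (simp add: lagrange_poly_def poly_sum poly_prod)
  also have "\<dots> = (\<Sum>w\<in>X. if w = y then f y else 0)"
  proof (rule sum.cong[OF refl])
    fix w assume "w \<in> X"
    show "f w / (\<Prod>z\<in>X - {w}. w - z) * (\<Prod>z\<in>X - {w}. y - z) = (if w = y then f y else 0)"
    proof (cases "w = y")
      case True
      have "(\<Prod>z\<in>X - {y}. y - z) \<noteq> 0" using assms by auto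
      with True show ?thesis by simp
    next
      case False
      then have "(\<Prod>z\<in>X - {w}. y - z) = 0" using assms by (intro prod_zero) auto
      with False show ?thesis by simp
    qed
  qed
  also have "\<dots> = f y" using assms by simp
  finally show ?thesis .
qed

lemma degree_lagrange: "finite X \<Longrightarrow> degree (lagrange_poly f X) \<le> card X - 1"
  unfolding lagrange_poly_def
  by (rule degree_sum_le) (auto simp: degree_prod_linear card_Diff_singleton)

lemma coeff_lagrange:
  assumes "finite X"
  shows "coeff (lagrange_poly f X) (card X - 1) = dd f X"
proof -
  have "coeff (\<Prod>z\<in>X - {y}. [:- z, 1::real:]) (card X - 1) = 1" if "y \<in> X" for y
  proof -
    have "degree (\<Prod>z\<in>X - {y}. [:- z, 1::real:]) = card X - 1"
      using that assms by (simp add: degree_prod_linear)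
    then have "coeff (\<Prod>z\<in>X - {y}. [:- z, 1::real:]) (card X - 1) = lead_coeff (\<Prod>z\<in>X - {y}. [:- z, 1::real:])"
      by simp
    also have "\<dots> = 1" by (simp add: lead_coeff_prod)
    finally show ?thesis .
  qed
  then show ?thesis by (simp add: lagrange_poly_def coeff_sum dd_def)
qed

text \<open>\<open>interpolating_poly\<close> is a definite description, so it needs a witness and
  uniqueness: the Lagrange polynomial is the former, and two polynomials of degree at most
  \<open>m\<close> that agree at \<open>m + 1\<close> distinct nodes coincide.\<close>

lemma divided_difference_eq_dd:
  assumes inj: "inj_on x {..m}"
  shows "divided_difference f x m = dd f (x ` {..m})"
proof -
  let ?X = "x ` {..m}"
  have card: "card ?X = Suc m" using inj by (simp add: card_image)
  have "interpolating_poly f x m = lagrange_poly f ?X"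
    unfolding interpolating_poly_def
  proof (rule the_equality)
    show "degree (lagrange_poly f ?X) \<le> m \<and> (\<forall>i\<le>m. poly (lagrange_poly f ?X) (x i) = f (x i))"
      using degree_lagrange[of ?X f] card by (simp add: poly_lagrange)
  next
    fix P assume P: "degree P \<le> m \<and> (\<forall>i\<le>m. poly P (x i) = f (x i))"
    show "P = lagrange_poly f ?X"
    proof (rule poly_eqI_degree[where A = ?X])
      show "poly P y = poly (lagrange_poly f ?X) y" if "y \<in> ?X" for y
        using that P by (auto simp: poly_lagrange)
      show "degree P < card ?X" "degree (lagrange_poly f ?X) < card ?X"
        using P card degree_lagrange[of ?X f] by auto
    qed
  qed
  then show ?thesis
    using coeff_lagrange[of ?X f] card by (simp add: divided_difference_def)
qed

lemma finite_set_strict_mono_enum: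
  fixes X :: "real set"
  assumes "finite X" "card X = Suc m"
  obtains x where "strict_mono_on {..m} x" "x ` {..m} = X"
proof
  let ?l = "sorted_list_of_set X"
  have len: "length ?l = Suc m" using assms by simp
  show "strict_mono_on {..m} ((!) ?l)"
    using strict_sorted_list_of_set[of X] len
    by (auto simp: strict_mono_on_def sorted_wrt_iff_nth_less)
  show "(!) ?l ` {..m} = X"
    using assms len nth_image[of "Suc m" ?l] by (simp add: lessThan_Suc_atMost atLeast0LessThan)
qed

text \<open>With node sets in place of increasing sequences, nodes can be inserted and exchanged
  without reordering. Nothing is lost, since every finite set of reals has an increasing
  enumeration.\<close>

lemma r_convex_on_iff_dd:
  "r_convex_on r J f \<longleftrightarrow> (\<forall>X. finite X \<and> card X = r + 2 \<and> X \<subseteq> J \<longrightarrow> 0 \<le> dd f X)"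
  (is "?L \<longleftrightarrow> ?R")
proof
  assume L: ?L
  show ?R
  proof (intro allI impI)
    fix X assume X: "finite X \<and> card X = r + 2 \<and> X \<subseteq> J"
    then obtain x where x: "strict_mono_on {..r + 1} x" "x ` {..r + 1} = X"
      using finite_set_strict_mono_enum[of X "r + 1"] by auto
    then have "0 \<le> divided_difference f x (r + 1)" using L X by (auto simp: r_convex_on_def)
    then show "0 \<le> dd f X"
      using divided_difference_eq_dd[of x "r + 1" f] x strict_mono_on_imp_inj_on by metis
  qed
next
  assume R: ?R
  show ?L
    unfolding r_convex_on_def
  proof (intro allI impI)
    fix x assume x: "strict_mono_on {..r + 1} x \<and> x ` {..r + 1} \<subseteq> J"
    then have inj: "inj_on x {..r + 1}" using strict_mono_on_imp_inj_on by blast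
    then have "card (x ` {..r + 1}) = r + 2" by (simp add: card_image)
    then have "0 \<le> dd f (x ` {..r + 1})" using R x by blast
    then show "0 \<le> divided_difference f x (r + 1)" using divided_difference_eq_dd[OF inj] by simp
  qed
qed

lemma r_concave_on_iff_r_convex_on: "r_concave_on r J f \<longleftrightarrow> r_convex_on r J (\<lambda>x. - 1 * f x)"
proof -
  have "divided_difference (\<lambda>x. - 1 * f x) x (r + 1) = - divided_difference f x (r + 1)"
    if "strict_mono_on {..r + 1} x" for x
    using divided_difference_eq_dd strict_mono_on_imp_inj_on[OF that] dd_cmult[of "-1" f] by simp
  then show ?thesis by (auto simp: r_convex_on_def r_concave_on_def)
qed

text \<open>The factor \<open>s\<close> handles convexity and concavity at once, so each later
  estimate is proved for a single signed inequality.\<close>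

lemma K_class_iff_dd:
  "f \<in> K_class r \<longleftrightarrow>
     (\<exists>J. right_unbounded_subinterval J \<and>
       (\<exists>s. (s = 1 \<or> s = -1) \<and>
         (\<forall>X. finite X \<and> card X = r + 2 \<and> X \<subseteq> J \<longrightarrow> 0 \<le> s * dd f X)))"
proof -
  have "(r_convex_on r J f \<or> r_concave_on r J f) \<longleftrightarrow>
      (\<exists>s. (s = 1 \<or> s = -1) \<and> (\<forall>X. finite X \<and> card X = r + 2 \<and> X \<subseteq> J \<longrightarrow> 0 \<le> s * dd f X))" for J
    unfolding r_concave_on_iff_r_convex_on r_convex_on_iff_dd dd_cmult
    by (simp add: conj_disj_distribR ex_disj_distrib)
  then show ?thesis by (simp add: K_class_def)
qed

section \<open>Arithmetic progressions and the Newton formula\<close>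

lemma dd_arith_progression:
  "dd f ((\<lambda>j. a + real j) ` {..k}) = (fdiff ^^ k) f a / fact k"
proof (induction k arbitrary: a)
  case 0
  then show ?case by simp
next
  case (Suc k)
  \<comment> \<open>The inner nodes \<open>a + 1, ..., a + k\<close>, shared by the progressions
    from \<open>a\<close> and from \<open>a + 1\<close>. The two outer nodes are
    \<open>k + 1\<close> apart, which turns \<open>fact k\<close> into
    \<open>fact (Suc k)\<close>.\<close>
  define X where "X = (\<lambda>j. a + 1 + real j) ` {..<k}"
  have e1: "(\<lambda>j. a + real j) ` {..k} = insert a X"
  proof -
    have "{..k} = insert 0 (Suc ` {..<k})"
      by (metis lessThan_Suc_atMost lessThan_Suc_eq_insert_0)
    then show ?thesis by (auto simp: X_def image_iff)
  qed
  have e2: "(\<lambda>j. a + 1 + real j) ` {..k} = insert (a + 1 + real k) X"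
  proof -
    have "{..k} = insert k {..<k}" by auto
    then show ?thesis by (simp add: X_def)
  qed
  have e3: "(\<lambda>j. a + real j) ` {..Suc k} = insert (a + 1 + real k) (insert a X)"
  proof -
    have "{..Suc k} = insert (Suc k) {..k}" by auto
    then show ?thesis using e1 by (simp add: add_ac)
  qed
  have "(a + 1 + real k - a) * dd f (insert (a + 1 + real k) (insert a X))
     = dd f (insert (a + 1 + real k) X) - dd f (insert a X)"
    by (rule dd_recursion) (auto simp: X_def)
  then have "(1 + real k) * dd f ((\<lambda>j. a + real j) ` {..Suc k}) = (fdiff ^^ k) f (a + 1) / fact k - (fdiff ^^ k) f a / fact k"
    unfolding e3 e2[symmetric] e1[symmetric] Suc.IH by simp
  also have "\<dots> = (fdiff ^^ Suc k) f a / fact k"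
    by (simp add: fdiff_def diff_divide_distrib)
  finally have "dd f ((\<lambda>j. a + real j) ` {..Suc k}) = (fdiff ^^ Suc k) f a / fact k / (1 + real k)"
    by (subst eq_divide_eq) (simp add: mult.commute)
  then show ?case by (simp add: mult.commute)
qed

text \<open>Nodes are appended one at a time: the recursion for the pair \<open>x\<close>,
  \<open>a + n\<close> splits the old remainder into the next Newton term and the new
  remainder.\<close>

lemma newton_remainder:
  assumes "x \<notin> (\<lambda>j. a + real j) ` {..<n}"
  shows "f x = (\<Sum>k<n. ((x - a) gchoose k) * (fdiff ^^ k) f a)
     + (\<Prod>j<n. x - a - real j) * dd f (insert x ((\<lambda>j. a + real j) ` {..<n}))"
  using assms
proof (induction n)
  case 0
  then show ?case by simp
next
  case (Suc n)
  let ?A = "(\<lambda>j. a + real j) ` {..<n}"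
  have i: "insert (a + real n) ?A = (\<lambda>j. a + real j) ` {..n}"
    by (simp add: lessThan_Suc lessThan_Suc_atMost[symmetric])
  have A: "(\<lambda>j. a + real j) ` {..<Suc n} = insert (a + real n) ?A" by (simp add: lessThan_Suc)
  have x: "x \<notin> ?A" "x \<noteq> a + real n" using Suc.prems by (auto simp: lessThan_Suc)
  have "(x - (a + real n)) * dd f (insert x (insert (a + real n) ?A)) = dd f (insert x ?A) - dd f (insert (a + real n) ?A)"
    using x by (intro dd_recursion) auto
  then have "dd f (insert x ?A) = (fdiff ^^ n) f a / fact n + (x - a - real n) * dd f (insert x (insert (a + real n) ?A))"
    using dd_arith_progression[of f a n] by (simp add: i algebra_simps)
  then have "(\<Prod>j<n. x - a - real j) * dd f (insert x ?A) = ((x - a) gchoose n) * (fdiff ^^ n) f a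
       + (\<Prod>j<Suc n. x - a - real j) * dd f (insert x (insert (a + real n) ?A))"
    by (simp add: gbinomial_prod_rev distrib_left atLeast0LessThan mult_ac)
  then show ?case using Suc.IH[OF x(1)] unfolding A by simp
qed

text \<open>Only the \<open>m\<close> nodes before \<open>a + m\<close> are used, so the evaluation
  point is not a node. Adding it completes the progression, and the remainder itself becomes the
  term \<open>k = m\<close>.\<close>

lemma newton_exact:
  "f (a + real m) = (\<Sum>k\<le>m. (real m gchoose k) * (fdiff ^^ k) f a)"
proof -
  let ?A = "(\<lambda>j. a + real j) ` {..<m}"
  have i: "insert (a + real m) ?A = (\<lambda>j. a + real j) ` {..m}"
    by (simp add: lessThan_Suc lessThan_Suc_atMost[symmetric])
  have "a + real m \<notin> ?A" by auto
  from newton_remainder[OF this, of f] show ?thesis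
    unfolding i dd_arith_progression
    by (simp add: gbinomial_prod_rev atLeast0LessThan lessThan_Suc_atMost[symmetric])
qed

section \<open>The mean value theorem for divided differences\<close>

lemma rolle_iterated:
  fixes D :: "nat \<Rightarrow> real \<Rightarrow> real"
  assumes der: "\<And>n x. l \<le> x \<Longrightarrow> x \<le> u \<Longrightarrow> (D n has_real_derivative D (Suc n) x) (at x)"
  assumes "\<And>i. i < m \<Longrightarrow> x i < x (Suc i)" "\<And>i. i \<le> m \<Longrightarrow> l \<le> x i \<and> x i \<le> u \<and> D k (x i) = 0"
  shows "\<exists>\<xi>. l \<le> \<xi> \<and> \<xi> \<le> u \<and> D (k + m) \<xi> = 0"
  using assms(2,3)
proof (induction m arbitrary: k x)
  case 0
  then show ?case by (metis add_0_right le0)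
next
  case (Suc m)
  have "\<exists>z>x i. z < x (Suc i) \<and> D (Suc k) z = 0" if "i \<le> m" for i
  proof -
    have b: "l \<le> x i" "x (Suc i) \<le> u" using Suc.prems(2) that by auto
    have "\<exists>z. x i < z \<and> z < x (Suc i) \<and> (*) (D (Suc k) z) = (\<lambda>v. 0)"
    proof (rule Rolle_deriv)
      show "x i < x (Suc i)" "D k (x i) = D k (x (Suc i))" using Suc.prems that by auto
      show "continuous_on {x i..x (Suc i)} (D k)"
        using der b by (intro continuous_at_imp_continuous_on) (meson DERIV_isCont atLeastAtMost_iff order_trans)
      show "(D k has_derivative (*) (D (Suc k) z)) (at z)" if "x i < z" "z < x (Suc i)" for z
        using der[of z k] that b by (simp add: has_field_derivative_def)
    qed
    then show ?thesis by (metis mult_1_right)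
  qed
  then obtain y where y: "\<And>i. i \<le> m \<Longrightarrow> x i < y i \<and> y i < x (Suc i) \<and> D (Suc k) (y i) = 0"
    by metis
  have "y i < y (Suc i)" if "i < m" for i
    using y[of i] y[of "Suc i"] that by auto
  moreover have "l \<le> y i \<and> y i \<le> u \<and> D (Suc k) (y i) = 0" if "i \<le> m" for i
    using y[OF that] Suc.prems(2)[of i] Suc.prems(2)[of "Suc i"] that by auto
  ultimately have "\<exists>\<xi>. l \<le> \<xi> \<and> \<xi> \<le> u \<and> D (Suc k + m) \<xi> = 0"
    by (rule Suc.IH)
  then show ?case by simp
qed

text \<open>The interpolation error has \<open>m + 1\<close> zeros, so its \<open>m\<close>th
  derivative has one; the \<open>m\<close>th derivative of the interpolating polynomial is the
  constant \<open>fact m\<close> times its coefficient of order \<open>m\<close>. All passages from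
  signs of derivatives to signs of divided differences rest on this.\<close>

lemma dd_mean_value:
  fixes D :: "nat \<Rightarrow> real \<Rightarrow> real"
  assumes der: "\<And>n x. l \<le> x \<Longrightarrow> x \<le> u \<Longrightarrow> (D n has_real_derivative D (Suc n) x) (at x)"
  assumes X: "finite X" "card X = Suc m" "X \<subseteq> {l..u}"
  shows "\<exists>\<xi>. l \<le> \<xi> \<and> \<xi> \<le> u \<and> dd (D 0) X = D m \<xi> / fact m"
proof -
  define P where "P = lagrange_poly (D 0) X"
  define E where "E n x = D n x - poly ((pderiv ^^ n) P) x" for n x
  have derE: "(E n has_real_derivative E (Suc n) x) (at x)" if "l \<le> x" "x \<le> u" for n x
    unfolding E_def funpow.simps o_def by (rule DERIV_diff[OF der[OF that] poly_DERIV])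
  obtain x where x: "strict_mono_on {..m} x" "x ` {..m} = X"
    using finite_set_strict_mono_enum[OF X(1,2)] by blast
  have "\<exists>\<xi>. l \<le> \<xi> \<and> \<xi> \<le> u \<and> E (0 + m) \<xi> = 0"
  proof (rule rolle_iterated[of l u E m x, OF derE])
    show "x i < x (Suc i)" if "i < m" for i
      using x(1) that by (auto simp: strict_mono_on_def)
    show "l \<le> x i \<and> x i \<le> u \<and> E 0 (x i) = 0" if "i \<le> m" for i
    proof -
      have "x i \<in> X" using that x(2) by auto
      then show ?thesis using X poly_lagrange[OF X(1), of "x i" "D 0"] by (auto simp: E_def P_def)
    qed
  qed auto
  then obtain \<xi> where \<xi>: "l \<le> \<xi>" "\<xi> \<le> u" "D m \<xi> = poly ((pderiv ^^ m) P) \<xi>" by (auto simp: E_def)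
  have "degree P \<le> m" using degree_lagrange[OF X(1), of "D 0"] X(2) by (simp add: P_def)
  moreover have "degree ((pderiv ^^ n) P) = degree P - n" for n
    by (induction n) (auto simp: degree_pderiv)
  ultimately have "degree ((pderiv ^^ m) P) = 0" by simp
  then have "poly ((pderiv ^^ m) P) \<xi> = coeff ((pderiv ^^ m) P) 0"
    by (elim degree_eq_zeroE) simp
  also have "\<dots> = fact m * coeff P m"
    by (simp add: coeff_higher_pderiv pochhammer_fact[symmetric])
  also have "coeff P m = dd (D 0) X"
    using coeff_lagrange[OF X(1), of "D 0"] X(2) by (simp add: P_def)
  finally show ?thesis using \<xi> by auto
qed

section \<open>Higher derivatives and their signs\<close>

text \<open>The derivatives are prescribed as a sequence, so that series and antiderivatives can be
  differentiated, shifted and rescaled without computing iterates of \<open>deriv\<close>; the link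
  to \<open>deriv\<close> is made once, in \<open>higher_deriv_deriv_seq\<close>.\<close>

definition deriv_seq :: "(nat \<Rightarrow> real \<Rightarrow> real) \<Rightarrow> bool" where
  "deriv_seq D \<longleftrightarrow> (\<forall>n. \<forall>x>0. (D n has_real_derivative D (Suc n) x) (at x))"

lemma deriv_seqD: "deriv_seq D \<Longrightarrow> 0 < x \<Longrightarrow> (D n has_real_derivative D (Suc n) x) (at x)"
  by (simp add: deriv_seq_def)

lemma deriv_seq_higher_deriv:
  "infinitely_differentiable_on f {0<..} \<Longrightarrow> deriv_seq (\<lambda>n. (deriv ^^ n) f)"
  by (simp add: deriv_seq_def infinitely_differentiable_on_def DERIV_deriv_iff_field_differentiable)

lemma higher_deriv_deriv_seq:
  assumes D: "deriv_seq D" and f: "\<And>x. 0 < x \<Longrightarrow> f x = D 0 x" and "0 < x"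
  shows "(deriv ^^ n) f x = D n x"
  using \<open>0 < x\<close>
proof (induction n arbitrary: x)
  case 0
  then show ?case by (simp add: f)
next
  case (Suc n)
  have "eventually (\<lambda>y. (deriv ^^ n) f y = D n y) (nhds x)"
    using eventually_nhds_in_open[of "{0<..}" x] Suc
    by (auto elim!: eventually_mono)
  then have "deriv ((deriv ^^ n) f) x = deriv (D n) x" by (rule deriv_cong_ev) simp
  also have "\<dots> = D (Suc n) x" using deriv_seqD[OF D Suc.prems] by (rule DERIV_imp_deriv)
  finally show ?case by simp
qed

lemma infinitely_differentiable_on_deriv_seq:
  assumes D: "deriv_seq D" and f: "\<And>x. 0 < x \<Longrightarrow> f x = D 0 x"
  shows "infinitely_differentiable_on f {0<..}"
  unfolding infinitely_differentiable_on_def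
proof (intro allI ballI)
  fix n and x :: real assume x: "x \<in> {0<..}"
  have "eventually (\<lambda>y. (deriv ^^ n) f y = D n y) (nhds x)"
    using eventually_nhds_in_open[of "{0<..}" x] x higher_deriv_deriv_seq[OF D f]
    by (auto elim!: eventually_mono)
  then have "((deriv ^^ n) f has_real_derivative D (Suc n) x) (at x) \<longleftrightarrow> (D n has_real_derivative D (Suc n) x) (at x)"
    by (intro DERIV_cong_ev) auto
  then show "(deriv ^^ n) f field_differentiable at x"
    using deriv_seqD[OF D] x by (auto simp: field_differentiable_def)
qed

lemma completely_monotone_on_deriv_seq:
  assumes "deriv_seq D" and "\<And>x. 0 < x \<Longrightarrow> f x = D 0 x"
    and "\<And>n x. 0 < x \<Longrightarrow> 0 \<le> (-1) ^ n * D n x"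
  shows "completely_monotone_on f {0<..}"
  using assms infinitely_differentiable_on_deriv_seq[OF assms(1,2)] higher_deriv_deriv_seq[OF assms(1,2)]
  by (simp add: completely_monotone_on_def)

lemma deriv_seq_shift: "deriv_seq D \<Longrightarrow> deriv_seq (\<lambda>n. D (n + k))"
  by (simp add: deriv_seq_def)

lemma deriv_seq_cmult: "deriv_seq D \<Longrightarrow> deriv_seq (\<lambda>n x. c * D n x)"
  by (auto simp: deriv_seq_def intro!: DERIV_cmult)

lemma deriv_seq_mean_value:
  assumes "deriv_seq D" "0 < x" "x < y"
  obtains z where "x < z" "z < y" "D n y - D n x = (y - x) * D (Suc n) z"
  using MVT2[of x y "D n" "D (Suc n)"] deriv_seqD[OF assms(1)] assms by auto

lemma deriv_seq_signed_mono:
  assumes D: "deriv_seq D" and "0 \<le> a" and s: "\<And>x. a < x \<Longrightarrow> 0 \<le> s * D (Suc n) x" and "a < x" "x \<le> y"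
  shows "s * D n x \<le> s * D n y"
proof (cases "x = y")
  case False
  with assms obtain z where "x < z" "z < y" "D n y - D n x = (y - x) * D (Suc n) z"
    using deriv_seq_mean_value[OF D, of x y n] by auto
  moreover have "s * D n y - s * D n x = s * (D n y - D n x)" by (simp add: algebra_simps)
  ultimately have "s * D n y - s * D n x = (y - x) * (s * D (Suc n) z)" by simp
  moreover have "0 \<le> (y - x) * (s * D (Suc n) z)" using assms \<open>x < z\<close> by simp
  ultimately show ?thesis by simp
qed simp

section \<open>Eventual signs and limits at infinity\<close>

definition eventually_signed :: "(real \<Rightarrow> real) \<Rightarrow> bool" where
  "eventually_signed h \<longleftrightarrow> (\<exists>s. (s = 1 \<or> s = -1) \<and> eventually (\<lambda>x. 0 \<le> s * h x) at_top)"

lemma eventually_signedI: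
  assumes "s = 1 \<or> s = -1" "\<And>x. a < x \<Longrightarrow> 0 \<le> s * h x"
  shows "eventually_signed h"
  unfolding eventually_signed_def using assms eventually_at_top_dense by blast

lemma eventually_signedE:
  assumes "eventually_signed h"
  obtains s a where "s = 1 \<or> s = -1" "0 < a" "\<And>x. a < x \<Longrightarrow> 0 \<le> s * h x"
proof -
  obtain s where s: "s = 1 \<or> s = -1" "eventually (\<lambda>x. 0 \<le> s * h x) at_top"
    using assms by (auto simp: eventually_signed_def)
  then obtain b where "\<And>x. b \<le> x \<Longrightarrow> 0 \<le> s * h x" by (auto simp: eventually_at_top_linorder)
  then show ?thesis using s(1) by (intro that[of s "max 1 b"]) auto
qed

text \<open>An eventually monotone function eventually has a constant sign: either it becomes
  nonnegative somewhere and stays so, or it is negative throughout. This carries signs from the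
  orders at least \<open>q\<close> down to all lower ones.\<close>

lemma eventually_signed_antideriv:
  assumes D: "deriv_seq D" and "eventually_signed (D (Suc n))"
  shows "eventually_signed (D n)"
proof -
  obtain s a where s: "s = 1 \<or> s = -1" and a: "0 < a" "\<And>x. a < x \<Longrightarrow> 0 \<le> s * D (Suc n) x"
    using assms(2) by (rule eventually_signedE) blast
  have mono: "s * D n x \<le> s * D n y" if "a < x" "x \<le> y" for x y
    using deriv_seq_signed_mono[OF D _ a(2) that] a(1) by simp
  show ?thesis
  proof (cases "\<exists>c>a. 0 \<le> s * D n c")
    case True
    then obtain c where "c > a" "0 \<le> s * D n c" by blast
    then have "\<And>x. c \<le> x \<Longrightarrow> 0 \<le> s * D n x" using mono order_trans by blast
    then show ?thesis
      unfolding eventually_signed_def using s eventually_at_top_linorder by blast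
  next
    case False
    then have "\<And>x. a < x \<Longrightarrow> 0 \<le> (- s) * D n x" by (auto simp: not_le intro: less_imp_le)
    moreover have "- s = 1 \<or> - s = -1" using s by auto
    ultimately show ?thesis
      unfolding eventually_signed_def using eventually_at_top_dense by blast
  qed
qed

lemma eventually_signed_all:
  assumes D: "deriv_seq D" and q: "\<And>n. q \<le> n \<Longrightarrow> eventually_signed (D n)"
  shows "eventually_signed (D n)"
proof (cases "q \<le> n")
  case False
  then have "n \<le> q" by simp
  then show ?thesis
    by (induction rule: inc_induct) (use q eventually_signed_antideriv[OF D] in auto)
qed (rule q)

lemma right_unbounded_greaterThan:
  assumes "0 \<le> a"
  shows "right_unbounded_subinterval {a<..}"
proof -
  have "\<exists>x\<in>{a<..}. \<not> x \<le> M" for M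
    by (rule bexI[of _ "max a M + 1"]) auto
  then show ?thesis
    using assms by (auto simp: right_unbounded_subinterval_def bdd_above_def is_interval_def)
qed

lemma eventually_signed_monotone:
  assumes D: "deriv_seq D" and "eventually_signed (D (Suc n))"
  shows "\<exists>J. right_unbounded_subinterval J \<and> (mono_on J (D n) \<or> antimono_on J (D n))"
proof -
  obtain s a where s: "s = 1 \<or> s = -1" and a: "0 < a" "\<And>x. a < x \<Longrightarrow> 0 \<le> s * D (Suc n) x"
    using assms(2) by (rule eventually_signedE) blast
  have "s * D n x \<le> s * D n y" if "a < x" "x \<le> y" for x y
    using deriv_seq_signed_mono[OF D _ a(2) that] a(1) by simp
  then have "mono_on {a<..} (D n) \<or> antimono_on {a<..} (D n)"
    using s by (auto simp: monotone_on_def)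
  moreover have "right_unbounded_subinterval {a<..}"
    using a(1) by (intro right_unbounded_greaterThan) simp
  ultimately show ?thesis by blast
qed

lemma tendsto_shift_diff:
  fixes h :: "real \<Rightarrow> real"
  assumes "(h \<longlongrightarrow> 0) at_top"
  shows "((\<lambda>x. h (x + 1) - h x) \<longlongrightarrow> 0) at_top"
proof -
  have "filterlim (\<lambda>x::real. x + 1) at_top at_top"
    using filterlim_tendsto_add_at_top[OF tendsto_const[of "1::real" at_top] filterlim_ident] by (simp add: add.commute)
  then have "((\<lambda>x. h (x + 1)) \<longlongrightarrow> 0) at_top"
    using filterlim_compose[OF assms] by blast
  from tendsto_diff[OF this assms] show ?thesis by simp
qed

text \<open>The derivative is eventually monotone, so by the mean value theorem its value at
  \<open>x\<close> lies between the unit differences of \<open>D n\<close> starting at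
  \<open>x - 1\<close> and at \<open>x\<close>. Asking only for vanishing differences is essential:
  for a solution of the difference equation, the derivative of order \<open>p\<close> need not tend
  to 0, but its difference does.\<close>

lemma deriv_tendsto_0:
  assumes D: "deriv_seq D" and lim: "((\<lambda>x. D n (x + 1) - D n x) \<longlongrightarrow> 0) at_top"
    and "eventually_signed (D (Suc (Suc n)))"
  shows "(D (Suc n) \<longlongrightarrow> 0) at_top"
proof -
  obtain s a where s: "s = 1 \<or> s = -1" and a: "0 < a" "\<And>x. a < x \<Longrightarrow> 0 \<le> s * D (Suc (Suc n)) x"
    using assms(3) by (rule eventually_signedE) blast
  have mono: "s * D (Suc n) x \<le> s * D (Suc n) y" if "a < x" "x \<le> y" for x y
    using deriv_seq_signed_mono[OF D _ a(2) that] a(1) by simp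
  have bounds: "s * D (Suc n) x \<le> s * (D n (x + 1) - D n x) \<and> s * (D n (x + 1) - D n x) \<le> s * D (Suc n) (x + 1)"
    if "a < x" for x
  proof -
    have "0 < x" "x < x + 1" using that a(1) by auto
    from deriv_seq_mean_value[OF D this, of n]
    obtain z where "x < z" "z < x + 1" "D n (x + 1) - D n x = (x + 1 - x) * D (Suc n) z" .
    then show ?thesis using mono[of x z] mono[of z "x + 1"] that by simp
  qed
  have up: "((\<lambda>x. s * (D n (x + 1) - D n x)) \<longlongrightarrow> 0) at_top"
    using tendsto_mult_right_zero[OF lim] by simp
  have shift: "filterlim (\<lambda>x::real. x - 1) at_top at_top"
    using filterlim_tendsto_add_at_top[OF tendsto_const[of "-1::real" at_top] filterlim_ident] by simp
  have lo: "((\<lambda>x. s * (D n x - D n (x - 1))) \<longlongrightarrow> 0) at_top"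
    using filterlim_compose[OF up shift] by simp
  have "((\<lambda>x. s * D (Suc n) x) \<longlongrightarrow> 0) at_top"
  proof (rule tendsto_sandwich[OF _ _ lo up])
    show "\<forall>\<^sub>F x in at_top. s * (D n x - D n (x - 1)) \<le> s * D (Suc n) x"
      using eventually_gt_at_top[of "a + 1"]
    proof eventually_elim
      case (elim x)
      with bounds[of "x - 1"] show ?case by simp
    qed
    show "\<forall>\<^sub>F x in at_top. s * D (Suc n) x \<le> s * (D n (x + 1) - D n x)"
      using eventually_gt_at_top[of a] by eventually_elim (use bounds in auto)
  qed
  from tendsto_mult_right_zero[OF this, of s] show ?thesis using s by auto
qed

lemma higher_derivs_tendsto_0:
  assumes D: "deriv_seq D" and lim: "((\<lambda>x. D p (x + 1) - D p x) \<longlongrightarrow> 0) at_top"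
    and sg: "\<And>n. eventually_signed (D n)" and n: "Suc p \<le> n"
  shows "(D n \<longlongrightarrow> 0) at_top"
  using n
proof (induction rule: dec_induct)
  case base
  show ?case using deriv_tendsto_0[OF D lim sg] .
next
  case (step n)
  show ?case using deriv_tendsto_0[OF D tendsto_shift_diff[OF step.IH] sg] .
qed

lemma signed_antideriv_of_tendsto_0:
  assumes D: "deriv_seq D" and lim: "(D n \<longlongrightarrow> 0) at_top"
    and t: "\<And>x. 0 < x \<Longrightarrow> 0 \<le> t * D (Suc n) x" and "0 < x"
  shows "0 \<le> (- t) * D n x"
proof -
  have "((\<lambda>y. t * D n y) \<longlongrightarrow> 0) at_top" using tendsto_mult_right_zero[OF lim] by simp
  moreover have "eventually (\<lambda>y. t * D n x \<le> t * D n y) at_top"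
    using eventually_ge_at_top[of x]
    by eventually_elim (use deriv_seq_signed_mono[OF D order_refl t \<open>0 < x\<close>] in auto)
  ultimately have "t * D n x \<le> 0"
    by (intro tendsto_lowerbound[of "\<lambda>y. t * D n y" 0 at_top]) auto
  then show ?thesis by simp
qed

text \<open>Signs are weak, so a derivative that vanishes identically has both of them, and signs
  chosen separately at each order need not alternate. Hence one sign is read off the first
  derivative and carried upwards by induction.\<close>

lemma alternating_signs:
  assumes D: "deriv_seq D" and lim: "\<And>n. (D n \<longlongrightarrow> 0) at_top"
    and sg: "\<And>n. (\<forall>x>0. 0 \<le> D (Suc n) x) \<or> (\<forall>x>0. D (Suc n) x \<le> 0)"
  shows "\<exists>s. (s = 1 \<or> s = -1) \<and> (\<forall>n. \<forall>x>0. 0 \<le> s * (-1) ^ n * D n x)"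
proof -
  have ex: "\<exists>t. (t = 1 \<or> t = -1) \<and> (\<forall>x>0. 0 \<le> t * D (Suc n) x)" for n
    using sg[of n] by (metis minus_mult_minus mult_1 mult_minus_left neg_0_le_iff_le)
  obtain t0 where t0: "t0 = 1 \<or> t0 = -1" "\<And>x. 0 < x \<Longrightarrow> 0 \<le> t0 * D (Suc 0) x" using ex[of 0] by blast
  have "\<forall>x>0. 0 \<le> (- t0) * (-1) ^ n * D n x" for n
  proof (induction n)
    case 0
    show ?case using signed_antideriv_of_tendsto_0[OF D lim t0(2)] by simp
  next
    case (Suc n)
    define s where "s = (- t0) * (-1) ^ n"
    have s: "s = 1 \<or> s = -1" using t0(1) by (auto simp: s_def minus_one_power_iff)
    have IH: "0 \<le> s * D n x" if "0 < x" for x using Suc.IH that by (simp add: s_def)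
    obtain t where t: "t = 1 \<or> t = -1" "\<And>x. 0 < x \<Longrightarrow> 0 \<le> t * D (Suc n) x" using ex[of n] by blast
    have "0 \<le> (- s) * D (Suc n) x" if x: "0 < x" for x
    proof (cases "t = s")
      case True
      \<comment> \<open>The limit 0 gives \<open>s * D n\<close> the sign opposite to the one from
        the induction hypothesis, which forces \<open>D n\<close>, and with it the next derivative,
        to vanish.\<close>
      have "D n y = 0" if "0 < y" for y
        using signed_antideriv_of_tendsto_0[OF D lim t(2) that] IH[OF that] True s by auto
      then have "(D n has_real_derivative 0) (at x)"
        using has_field_derivative_transform_within_open[of "\<lambda>_. 0" 0 x "{0<..}" "D n"] x by simp
      then have "D (Suc n) x = 0" using DERIV_unique deriv_seqD[OF D x] by blast
      then show ?thesis by simp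
    next
      case False
      then have "- s = t" using s t by auto
      then show ?thesis using t(2)[OF x] by simp
    qed
    then show ?case by (simp add: s_def)
  qed
  then show ?thesis using t0(1) by (intro exI[of _ "- t0"]) auto
qed

section \<open>Taylor and Newton expansions\<close>

lemma taylor_at_positive:
  assumes D: "deriv_seq D" and "0 < c" "0 < x" "x \<noteq> c" "0 < n"
  obtains t where "min x c < t" "t < max x c"
    "D 0 x = (\<Sum>m<n. D m c / fact m * (x - c) ^ m) + D n t / fact n * (x - c) ^ n"
proof -
  have "\<exists>t. (if x < c then x < t \<and> t < c else c < t \<and> t < x) \<and>
     D 0 x = (\<Sum>m<n. D m c / fact m * (x - c) ^ m) + D n t / fact n * (x - c) ^ n"
    using assms deriv_seqD[OF D] by (intro Taylor[where a = "min x c" and b = "max x c"]) auto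
  then show ?thesis using that \<open>x \<noteq> c\<close> by (auto split: if_splits)
qed

text \<open>Expanding at \<open>b\<close> and evaluating at \<open>b / 2\<close>, every Taylor term and the remainder are
  nonnegative, so each term is bounded by the value at \<open>b / 2\<close>.\<close>

lemma alternating_deriv_bound:
  assumes D: "deriv_seq D" and sg: "\<And>n x. 0 < x \<Longrightarrow> 0 \<le> (-1) ^ n * D n x" and "0 < b"
  shows "\<bar>D m b\<bar> / fact m * (b / 2) ^ m \<le> D 0 (b / 2)"
proof -
  obtain t where t: "min (b / 2) b < t"
    "D 0 (b / 2) = (\<Sum>k<Suc m. D k b / fact k * (b / 2 - b) ^ k) + D (Suc m) t / fact (Suc m) * (b / 2 - b) ^ Suc m"
    using taylor_at_positive[OF D, of b "b / 2" "Suc m"] \<open>0 < b\<close> by auto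
  have eq: "D k x / fact k * (b / 2 - b) ^ k = (-1) ^ k * D k x / fact k * (b / 2) ^ k" for k x
  proof -
    have "(b / 2 - b) ^ k = (-1) ^ k * (b / 2) ^ k"
      by (simp add: power_mult_distrib[symmetric])
    then show ?thesis by simp
  qed
  have nonneg: "0 \<le> D k x / fact k * (b / 2 - b) ^ k" if "0 < x" for k x
    unfolding eq using sg[OF that, of k] \<open>0 < b\<close> by simp
  have "\<bar>D m b\<bar> = (-1) ^ m * D m b"
    using sg[OF \<open>0 < b\<close>, of m] by (cases "even m") auto
  then have "\<bar>D m b\<bar> / fact m * (b / 2) ^ m = D m b / fact m * (b / 2 - b) ^ m"
    by (simp only: eq)
  also have "\<dots> \<le> (\<Sum>k<Suc m. D k b / fact k * (b / 2 - b) ^ k)"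
    using nonneg[OF \<open>0 < b\<close>] by (intro member_le_sum) auto
  also have "\<dots> \<le> D 0 (b / 2)"
    using t \<open>0 < b\<close> nonneg[of t "Suc m"] by (simp del: power_Suc fact_Suc)
  finally show ?thesis .
qed

text \<open>As \<open>D 0\<close> decreases, the worst case of the previous bound for
  \<open>y\<close> beyond \<open>a / 2\<close> is \<open>y = a / 2\<close>. The result is a Cauchy
  estimate of radius \<open>a / 4\<close>, uniform over all intermediate points that a Taylor
  remainder near \<open>a\<close> can produce.\<close>

lemma alternating_deriv_uniform_bound:
  assumes D: "deriv_seq D" and sg: "\<And>n x. 0 < x \<Longrightarrow> 0 \<le> (-1) ^ n * D n x"
    and a: "0 < a" and y: "a / 2 \<le> y"
  shows "\<bar>D m y\<bar> \<le> D 0 (a / 4) * fact m * (4 / a) ^ m"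
proof -
  have y0: "0 < y" using a y by simp
  have "(-1) * D 0 (a / 4) \<le> (-1) * D 0 (y / 2)"
    using deriv_seq_signed_mono[OF D order_refl, of "-1" 0 "a / 4" "y / 2"] sg[of _ 1] a y by auto
  then have "\<bar>D m y\<bar> / fact m * (y / 2) ^ m \<le> D 0 (a / 4)"
    using alternating_deriv_bound[OF D sg y0, of m] by simp
  moreover have "\<bar>D m y\<bar> / fact m * (a / 4) ^ m \<le> \<bar>D m y\<bar> / fact m * (y / 2) ^ m"
    using a y by (intro mult_left_mono power_mono) auto
  ultimately have "\<bar>D m y\<bar> / fact m * (a / 4) ^ m \<le> D 0 (a / 4)" by simp
  then have "\<bar>D m y\<bar> / fact m * (a / 4) ^ m * (fact m * (4 / a) ^ m) \<le> D 0 (a / 4) * (fact m * (4 / a) ^ m)"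
    using a by (intro mult_right_mono) auto
  moreover have "\<bar>D m y\<bar> / fact m * (a / 4) ^ m * (fact m * (4 / a) ^ m) = \<bar>D m y\<bar> * ((a / 4) ^ m * (4 / a) ^ m)"
    by simp
  moreover have "(a / 4) ^ m * (4 / a) ^ m = 1"
    using a by (simp add: power_mult_distrib[symmetric])
  ultimately show ?thesis by (simp only: mult.assoc mult_1_right)
qed

text \<open>Alternation starts only at order \<open>q\<close>, so the bound is applied to the
  \<open>q\<close>th derivative and the Taylor remainder is taken at order \<open>m + q\<close>,
  where \<open>fact (m + q)\<close> absorbs \<open>fact m\<close>.\<close>

lemma real_analytic_on_of_alternating:
  assumes D: "deriv_seq D" and s: "s = 1 \<or> s = -1"
    and sg: "\<And>n x. 0 < x \<Longrightarrow> 0 \<le> s * (-1) ^ n * D (n + q) x"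
    and f: "\<And>x. 0 < x \<Longrightarrow> f x = D 0 x"
  shows "real_analytic_on f {0<..}"
  unfolding real_analytic_on_def
proof
  fix a :: real assume "a \<in> {0<..}"
  then have a: "0 < a" by simp
  define E where "E n x = s * D (n + q) x" for n x
  have E: "deriv_seq E" unfolding E_def by (rule deriv_seq_cmult[OF deriv_seq_shift[OF D]])
  have sgE: "0 \<le> (-1) ^ n * E n x" if "0 < x" for n x
    using sg[OF that, of n] by (simp add: E_def mult_ac)
  define M where "M = E 0 (a / 4)"
  have bound: "\<bar>D (m + q) y\<bar> \<le> M * fact m * (4 / a) ^ m" if "a / 2 \<le> y" for m y
    using alternating_deriv_uniform_bound[OF E sgE a that, of m] s
    by (auto simp: E_def M_def abs_mult)
  have M0: "0 \<le> M" using sgE[of "a / 4" 0] a by (simp add: M_def)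
  \<comment> \<open>The radius \<open>a / 8\<close> keeps the intermediate point above
    \<open>a / 2\<close> and makes the remainders decay with ratio
    \<open>(4 / a) * (a / 8) = 1 / 2\<close>.\<close>
  have "(\<lambda>n. D n a / fact n * (x - a) ^ n) sums f x" if x: "x \<in> {0<..}" "\<bar>x - a\<bar> < a / 8" for x
  proof (cases "x = a")
    case True
    have "(\<lambda>n. D n a / fact n * 0 ^ n) sums (D 0 a / fact 0)"
      using sums_finite[of "{0}" "\<lambda>n. D n a / fact n * 0 ^ n"] by simp
    then show ?thesis using True a f by simp
  next
    case False
    have rem: "\<bar>f x - (\<Sum>n<m + q. D n a / fact n * (x - a) ^ n)\<bar> \<le> M * (a / 8) ^ q * (1 / 2) ^ m" if m: "0 < m" for m
    proof -
      obtain t where t: "min x a < t"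
        "D 0 x = (\<Sum>n<m + q. D n a / fact n * (x - a) ^ n) + D (m + q) t / fact (m + q) * (x - a) ^ (m + q)"
        using taylor_at_positive[OF D a _ False, of "m + q"] x m by auto
      have "a / 2 \<le> t" using t(1) x a by (auto simp: min_def abs_if split: if_splits)
      then have b: "\<bar>D (m + q) t\<bar> \<le> M * fact m * (4 / a) ^ m" by (rule bound)
      have "\<bar>f x - (\<Sum>n<m + q. D n a / fact n * (x - a) ^ n)\<bar> = \<bar>D (m + q) t\<bar> / fact (m + q) * \<bar>x - a\<bar> ^ (m + q)"
        using t(2) f x by (simp add: abs_mult power_abs)
      also have "\<dots> \<le> (M * fact m * (4 / a) ^ m) / fact m * (a / 8) ^ (m + q)"
      proof (intro mult_mono frac_le power_mono b)
        show "(fact m :: real) \<le> fact (m + q)" by (intro fact_mono) simp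
      qed (use M0 a x in auto)
      also have "\<dots> = M * (a / 8) ^ q * ((4 / a) * (a / 8)) ^ m"
        unfolding power_add power_mult_distrib by simp
      also have "(4 / a) * (a / 8) = 1 / 2" using a by simp
      finally show ?thesis .
    qed
    have "(\<lambda>m. f x - (\<Sum>n<m + q. D n a / fact n * (x - a) ^ n)) \<longlonglongrightarrow> 0"
    proof (rule Lim_null_comparison)
      show "\<forall>\<^sub>F m in sequentially. norm (f x - (\<Sum>n<m + q. D n a / fact n * (x - a) ^ n)) \<le> M * (a / 8) ^ q * (1 / 2) ^ m"
        using eventually_gt_at_top[of 0] by eventually_elim (use rem in auto)
      show "(\<lambda>m. M * (a / 8) ^ q * (1 / 2) ^ m) \<longlonglongrightarrow> 0"
        by (intro tendsto_mult_right_zero LIMSEQ_realpow_zero) auto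
    qed
    from tendsto_diff[OF tendsto_const[of "f x"] this]
    have "(\<lambda>m. \<Sum>n<m + q. D n a / fact n * (x - a) ^ n) \<longlonglongrightarrow> f x" by simp
    then show ?thesis unfolding sums_def by (rule LIMSEQ_offset)
  qed
  then show "\<exists>c. \<exists>\<rho>>0. \<forall>x\<in>{0<..}. \<bar>x - a\<bar> < \<rho> \<longrightarrow> (\<lambda>n. c n * (x - a) ^ n) sums f x"
    using a by (intro exI[of _ "\<lambda>n. D n a / fact n"] exI[of _ "a / 8"]) auto
qed

section \<open>Convergence of the Newton series\<close>

lemma gchoose_ratio_tendsto_0:
  fixes w z :: real
  assumes "w < z" "w \<notin> \<nat>"
  shows "(\<lambda>n. (z gchoose n) / (w gchoose n)) \<longlonglongrightarrow> 0"
proof -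
  \<comment> \<open>For positive \<open>n\<close> this is the power of \<open>n\<close> with
    exponent \<open>u + 1\<close>, the growth rate in the asymptotics of \<open>u gchoose n\<close>.
    The quotient for \<open>z\<close> and \<open>w\<close> thus behaves like a constant times
    \<open>n\<close> to the power \<open>w - z\<close>.\<close>
  define e where "e u n = exp ((u + 1) * ln (real n))" for u :: real and n
  have lim: "(\<lambda>n. (u gchoose n) * (-1) ^ n * e u n) \<longlonglongrightarrow> rGamma (- u)" for u
  proof -
    have "(u gchoose n) / ((-1) ^ n / exp ((u + 1) * of_real (ln (real n)))) = (u gchoose n) * (-1) ^ n * e u n" for n
      by (cases "even n") (simp_all add: e_def)
    then show ?thesis using gbinomial_asymptotic[of u] by (simp add: rGamma_inverse_Gamma)
  qed
  \<comment> \<open>Only the denominator needs a nonzero limit; \<open>rGamma\<close> is finite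
    everywhere, so \<open>z\<close> may be a natural number.\<close>
  have "- w \<notin> \<int>\<^sub>\<le>\<^sub>0"
  proof
    assume "- w \<in> \<int>\<^sub>\<le>\<^sub>0"
    then obtain n where "- w = - real n" by (auto elim: nonpos_Ints_cases')
    then have "w \<in> \<nat>" by simp
    with assms(2) show False ..
  qed
  then have nz: "rGamma (- w) \<noteq> 0" by (simp add: rGamma_eq_zero_iff)
  have "(\<lambda>n. exp (- (z - w) * ln (real n))) \<longlonglongrightarrow> 0"
  proof -
    have "filterlim (\<lambda>n. ln (real n)) at_top sequentially"
      by (rule filterlim_compose[OF ln_at_top filterlim_real_sequentially])
    then have "filterlim (\<lambda>n. - (z - w) * ln (real n)) at_bot sequentially"
      using assms(1) by (intro filterlim_tendsto_neg_mult_at_bot[OF tendsto_const]) auto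
    then show ?thesis by (rule filterlim_compose[OF exp_at_bot])
  qed
  from tendsto_mult[OF tendsto_divide[OF lim[of z] lim[of w] nz] this]
  have "(\<lambda>n. ((z gchoose n) * (-1) ^ n * e z n) / ((w gchoose n) * (-1) ^ n * e w n) * exp (- (z - w) * ln (real n))) \<longlonglongrightarrow> 0"
    by simp
  moreover have "((z gchoose n) * (-1) ^ n * e z n) / ((w gchoose n) * (-1) ^ n * e w n) * exp (- (z - w) * ln (real n))
      = (z gchoose n) / (w gchoose n)" for n
  proof -
    have e: "e z n * exp (- (z - w) * ln (real n)) = e w n"
      by (simp add: e_def exp_add[symmetric] algebra_simps)
    have "((z gchoose n) * (-1) ^ n * e z n) / ((w gchoose n) * (-1) ^ n * e w n) * exp (- (z - w) * ln (real n))
      = ((z gchoose n) / (w gchoose n)) * ((-1) ^ n / (-1) ^ n) * ((e z n * exp (- (z - w) * ln (real n))) / e w n)"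
      by (simp add: mult_ac)
    also have "\<dots> = (z gchoose n) / (w gchoose n)"
      unfolding e by (simp add: e_def)
    finally show ?thesis .
  qed
  ultimately show ?thesis by simp
qed

lemma dd_sign_of_deriv_sign:
  assumes D: "deriv_seq D" and f: "\<And>x. 0 < x \<Longrightarrow> f x = D 0 x"
    and X: "finite X" "card X = Suc m" "X \<subseteq> {a<..}" and "0 \<le> a"
    and s: "\<And>x. a < x \<Longrightarrow> 0 \<le> s * D m x"
  shows "0 \<le> s * dd f X"
proof -
  have ne: "X \<noteq> {}" using X by auto
  have sub: "X \<subseteq> {Min X..Max X}" and min: "a < Min X" using X ne by auto
  have "dd f X = dd (D 0) X"
    unfolding dd_def using X(3) f \<open>0 \<le> a\<close> by (intro sum.cong) auto
  moreover obtain \<xi> where "Min X \<le> \<xi>" "dd (D 0) X = D m \<xi> / fact m"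
    using dd_mean_value[of "Min X" "Max X" D X m] deriv_seqD[OF D] min \<open>0 \<le> a\<close> X(1,2) sub by force
  moreover have "0 \<le> s * D m \<xi>" using s min \<open>Min X \<le> \<xi>\<close> by simp
  ultimately show ?thesis by simp
qed

text \<open>The remainder is \<open>n! * ((x - a) gchoose n)\<close> times a divided difference that is eventually
  alternating in \<open>n\<close> and monotone in \<open>x\<close>. At a point \<open>x' < x\<close> the absolute value of the
  remainder eventually decreases, and the quotient of the two binomial coefficients vanishes in
  the limit.\<close>

lemma newton_series_of_alternating:
  assumes D: "deriv_seq D" and f: "\<And>x. 0 < x \<Longrightarrow> f x = D 0 x" and s: "s = 1 \<or> s = -1"
    and sg: "\<And>n x. q \<le> n \<Longrightarrow> 0 < x \<Longrightarrow> 0 \<le> s * (-1) ^ n * D n x"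
    and a: "0 < a"
  shows "admits_newton_series f {0<..} a"
  unfolding admits_newton_series_def
proof
  fix x :: real assume "x \<in> {0<..}"
  then have x: "0 < x" by simp
  show "(\<lambda>k. ((x - a) gchoose k) * (fdiff ^^ k) f a) sums f x"
  proof (cases "x - a \<in> \<nat>")
    case True
    then obtain m where m: "x - a = real m" by (auto elim: Nats_cases)
    have "(\<lambda>k. (real m gchoose k) * (fdiff ^^ k) f a) sums (\<Sum>k\<le>m. (real m gchoose k) * (fdiff ^^ k) f a)"
      by (rule sums_finite) (auto simp: binomial_gbinomial[symmetric])
    then show ?thesis using newton_exact[of f a m] m by (simp add: algebra_simps)
  next
    case False
    define A where "A n = (\<lambda>j. a + real j) ` {..<n}" for n
    \<comment> \<open>The midpoint between \<open>x\<close> and the larger of 0 and the last point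
      of the form \<open>a +\<close> integer below \<open>x\<close>. Thus \<open>x'\<close> is
      positive and \<open>x' - a\<close> lies strictly between two consecutive integers, so
      \<open>x'\<close> is no node.\<close>
    define x' where "x' = (max 0 (a + real_of_int (\<lceil>x - a\<rceil> - 1)) + x) / 2"
    have ceil: "a + real_of_int (\<lceil>x - a\<rceil> - 1) < x" "x \<le> a + real_of_int \<lceil>x - a\<rceil>" by linarith+
    have x': "0 < x'" "x' < x" "a + real_of_int (\<lceil>x - a\<rceil> - 1) < x'" using x ceil by (auto simp: x'_def)
    have w: "x' - a \<notin> \<nat>"
    proof
      assume "x' - a \<in> \<nat>"
      then obtain m where "x' - a = real m" by (auto elim: Nats_cases)
      then have "real_of_int (\<lceil>x - a\<rceil> - 1) < real_of_int (int m)" "real_of_int (int m) < real_of_int \<lceil>x - a\<rceil>"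
        using x' ceil by auto
      then show False unfolding of_int_less_iff by simp
    qed
    have notin: "y \<notin> A n" if "y - a \<notin> \<nat>" for y n using that by (auto simp: A_def)
    have finA: "finite (A n)" and cardA: "card (A n) = n" and posA: "A n \<subseteq> {0<..}" for n
      using a by (auto simp: A_def card_image inj_on_def)
    define c where "c n y = s * (-1) ^ n * dd f (insert y (A n))" for n y
    have dd_sign: "0 \<le> s * (-1) ^ m * dd f X" if "finite X" "card X = Suc m" "X \<subseteq> {0<..}" "q \<le> m" for X m
      using dd_sign_of_deriv_sign[OF D f that(1-3) order_refl, of "s * (-1) ^ m"] sg[OF that(4)] by simp
    have c_nonneg: "0 \<le> c n y" if "q \<le> n" "0 < y" "y - a \<notin> \<nat>" for n y
      unfolding c_def using notin[OF that(3)] finA cardA posA that by (intro dd_sign) auto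
    \<comment> \<open>Exchanging \<open>x'\<close> for \<open>x\<close> costs a divided difference
      of the next order, whose sign is opposite; hence the normalised coefficient decreases in its
      argument.\<close>
    have c_mono: "c n x \<le> c n x'" if "q \<le> n" for n
    proof -
      have "(x - x') * dd f (insert x (insert x' (A n))) = dd f (insert x (A n)) - dd f (insert x' (A n))"
        using notin[OF False] notin[OF w] x'(2) finA by (intro dd_recursion) auto
      then have e: "dd f (insert x' (A n)) = dd f (insert x (A n)) - (x - x') * dd f (insert x (insert x' (A n)))"
        by simp
      have "c n x' - c n x = (x - x') * (s * (-1) ^ Suc n * dd f (insert x (insert x' (A n))))"
        unfolding c_def e by (simp add: algebra_simps)
      moreover have "0 \<le> s * (-1) ^ Suc n * dd f (insert x (insert x' (A n)))"
        using notin[OF False] notin[OF w] x' x finA cardA posA that by (intro dd_sign) auto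
      moreover have "0 \<le> x - x'" using x'(2) by simp
      ultimately have "0 \<le> c n x' - c n x" by (simp only: mult_nonneg_nonneg)
      then show ?thesis by simp
    qed
    define R where "R n y = (\<Prod>j<n. y - a - real j) * dd f (insert y (A n))" for n y
    have Rabs: "\<bar>R n y\<bar> = \<bar>\<Prod>j<n. y - a - real j\<bar> * c n y" if "q \<le> n" "0 < y" "y - a \<notin> \<nat>" for n y
    proof -
      have "\<bar>c n y\<bar> = \<bar>dd f (insert y (A n))\<bar>" using s by (auto simp: c_def abs_mult)
      then show ?thesis using c_nonneg[OF that] by (simp add: R_def abs_mult)
    qed
    \<comment> \<open>Beyond \<open>N\<close> the signs alternate and the new factor
      \<open>x' - a - n\<close> of the product is nonpositive, so its absolute value is
      \<open>n - (x' - a)\<close>.\<close>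
    obtain N where N: "q \<le> N" "x' - a \<le> real N"
      by (metis max.cobounded1 max.coboundedI2 of_nat_le_iff order_trans real_arch_simple)
    have Rdecr: "\<bar>R (Suc n) x'\<bar> \<le> \<bar>R n x'\<bar>" if n: "N \<le> n" for n
    proof -
      have qn: "q \<le> n" and wn: "x' - a \<le> real n" using N n by auto
      have A: "insert (a + real n) (A n) = A (Suc n)" by (simp add: A_def lessThan_Suc)
      have new: "a + real n \<notin> A n" by (auto simp: A_def)
      have ne: "x' \<noteq> a + real n" using w by auto
      have "(x' - (a + real n)) * dd f (insert x' (insert (a + real n) (A n))) = dd f (insert x' (A n)) - dd f (insert (a + real n) (A n))"
        using notin[OF w] new ne finA by (intro dd_recursion) auto
      then have e: "dd f (insert x' (A n)) = dd f (A (Suc n)) + (x' - a - real n) * dd f (insert x' (A (Suc n)))"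
        by (simp add: A algebra_simps)
      \<comment> \<open>The last summand is nonnegative, and the factor before
        \<open>c (Suc n) x'\<close> is exactly the one that the product gains.\<close>
      have "c n x' = (real n - (x' - a)) * c (Suc n) x' + s * (-1) ^ n * dd f (A (Suc n))"
        unfolding c_def e by (simp add: algebra_simps)
      moreover have "0 \<le> s * (-1) ^ n * dd f (A (Suc n))"
        using finA cardA posA qn by (intro dd_sign) auto
      ultimately have "(real n - (x' - a)) * c (Suc n) x' \<le> c n x'" by simp
      then have "\<bar>\<Prod>j<n. x' - a - real j\<bar> * ((real n - (x' - a)) * c (Suc n) x') \<le> \<bar>\<Prod>j<n. x' - a - real j\<bar> * c n x'"
        by (rule mult_left_mono) simp
      moreover have "\<bar>x' - a - real n\<bar> = real n - (x' - a)" using wn by simp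
      ultimately show ?thesis
        using Rabs[OF _ x'(1) w, of "Suc n"] Rabs[OF qn x'(1) w] qn
        by (simp add: abs_mult mult_ac)
    qed
    have Rbound: "\<bar>R n x'\<bar> \<le> \<bar>R N x'\<bar>" if "N \<le> n" for n
      using that by (induction rule: dec_induct) (use Rdecr in force)+
    have ratio: "\<bar>R n x\<bar> \<le> \<bar>R N x'\<bar> * \<bar>((x - a) gchoose n) / ((x' - a) gchoose n)\<bar>" if n: "N \<le> n" for n
    proof -
      have qn: "q \<le> n" using N n by simp
      let ?P = "\<lambda>y. \<Prod>j<n. y - a - real j"
      have P: "?P y = fact n * ((y - a) gchoose n)" for y
        by (simp add: gbinomial_prod_rev atLeast0LessThan)
      have nz: "?P x' \<noteq> 0" using w by (auto simp: prod_zero_iff)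
      have "\<bar>R n x\<bar> \<le> \<bar>?P x\<bar> * c n x'"
        unfolding Rabs[OF qn x False] using c_mono[OF qn] by (intro mult_left_mono) auto
      also have "\<dots> = \<bar>?P x / ?P x'\<bar> * \<bar>R n x'\<bar>"
        unfolding Rabs[OF qn x'(1) w] using nz by (simp add: abs_divide)
      also have "\<dots> \<le> \<bar>?P x / ?P x'\<bar> * \<bar>R N x'\<bar>"
        using Rbound[OF n] by (intro mult_left_mono) auto
      also have "?P x / ?P x' = ((x - a) gchoose n) / ((x' - a) gchoose n)"
        unfolding P by simp
      finally show ?thesis by (simp only: mult.commute)
    qed
    have "(\<lambda>n. R n x) \<longlonglongrightarrow> 0"
    proof (rule Lim_null_comparison)
      show "\<forall>\<^sub>F n in sequentially. norm (R n x) \<le> \<bar>R N x'\<bar> * \<bar>((x - a) gchoose n) / ((x' - a) gchoose n)\<bar>"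
        using eventually_ge_at_top[of N] by eventually_elim (use ratio in auto)
      show "(\<lambda>n. \<bar>R N x'\<bar> * \<bar>((x - a) gchoose n) / ((x' - a) gchoose n)\<bar>) \<longlonglongrightarrow> 0"
        using gchoose_ratio_tendsto_0[of "x' - a" "x - a"] w x'(2)
        by (intro tendsto_mult_right_zero tendsto_rabs_zero) auto
    qed
    from tendsto_diff[OF tendsto_const[of "f x"] this]
    have "(\<lambda>n. f x - R n x) \<longlonglongrightarrow> f x" by simp
    moreover have "f x - R n x = (\<Sum>k<n. ((x - a) gchoose k) * (fdiff ^^ k) f a)" for n
      using newton_remainder[of x a n f] notin[OF False, of n] by (simp add: R_def A_def)
    ultimately show ?thesis by (simp add: sums_def)
  qed
qed

section \<open>Uniqueness of the principal solution\<close>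

lemma funpow_fdiff_cong:
  assumes "\<And>x. 0 < x \<Longrightarrow> u x = v x" "0 < x"
  shows "(fdiff ^^ k) u x = (fdiff ^^ k) v x"
  using assms(2) by (induction k arbitrary: x) (simp_all add: assms(1) fdiff_def)

lemma funpow_fdiff_Suc:
  assumes "\<And>x. 0 < x \<Longrightarrow> fdiff f x = g x" "0 < x"
  shows "(fdiff ^^ Suc k) f x = (fdiff ^^ k) g x"
  using funpow_fdiff_cong[of "fdiff f" g x k] assms by (simp add: funpow_Suc_right del: funpow.simps)

lemma D_class_mono:
  assumes "g \<in> D_class r" "r \<le> k"
  shows "g \<in> D_class k"
  using assms(2)
proof (induction rule: dec_induct)
  case (step k)
  then have lim: "(\<lambda>n. (fdiff ^^ k) g (real n)) \<longlonglongrightarrow> 0" by (simp add: D_class_def)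
  from tendsto_diff[OF LIMSEQ_Suc[OF lim] lim]
  show ?case by (simp add: D_class_def fdiff_def add.commute)
qed (rule assms(1))

lemma right_unbounded_subintervalE:
  assumes "right_unbounded_subinterval J"
  obtains c where "0 < c" "{c..} \<subseteq> J"
proof -
  have J: "is_interval J" "J \<subseteq> {0<..}" "\<not> bdd_above J"
    using assms by (auto simp: right_unbounded_subinterval_def)
  then have big: "\<exists>d\<in>J. y < d" for y by (auto simp: bdd_above_def not_le)
  then obtain c where c: "c \<in> J" by blast
  have "y \<in> J" if "c \<le> y" for y
  proof -
    obtain d where "d \<in> J" "y < d" using big by blast
    then show ?thesis using J(1) c that unfolding is_interval_1 by (meson less_imp_le)
  qed
  then show ?thesis using that[of c] c J(2) by auto
qed

text \<open>Convexity makes the divided differences of order \<open>r\<close> monotone in each node, which traps the one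
  over \<open>a + x, a + 1, \<dots>, a + r\<close> between those over \<open>a, \<dots>, a + r\<close> and \<open>a + 1, \<dots>, a + 1 + r\<close>.\<close>

lemma K_class_interpolation_bound:
  assumes convex: "\<And>X. finite X \<Longrightarrow> card X = r + 2 \<Longrightarrow> X \<subseteq> {a..} \<Longrightarrow> 0 \<le> s * dd f X"
    and s: "s = 1 \<or> s = -1" and x: "0 < x" "x < 1"
  shows "\<bar>f (a + x) - (\<Sum>k\<le>r. (x gchoose k) * (fdiff ^^ k) f a)\<bar>
    \<le> \<bar>\<Prod>j\<le>r. x - real j\<bar> / x * (\<bar>(fdiff ^^ Suc r) f a\<bar> / fact r)"
proof -
  define B where "B = (\<lambda>j. a + 1 + real j) ` {..<r}"
  define T where "T = dd f (insert (a + x) (insert a B))"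
  have A: "(\<lambda>j. a + real j) ` {..r} = insert a B"
  proof -
    have "{..r} = insert 0 (Suc ` {..<r})" by (metis lessThan_Suc_atMost lessThan_Suc_eq_insert_0)
    then show ?thesis by (auto simp: B_def image_iff)
  qed
  have A': "(\<lambda>j. a + 1 + real j) ` {..r} = insert (a + 1 + real r) B"
    by (simp add: B_def lessThan_Suc_atMost[symmetric] lessThan_Suc)
  have B: "finite B" "card B = r" "B \<subseteq> {a..}" by (auto simp: B_def card_image inj_on_def)
  have notin: "a \<notin> B" "a + x \<notin> B" "a + 1 + real r \<notin> B"
  proof -
    show "a + x \<notin> B" using x by (auto simp: B_def)
  qed (auto simp: B_def)
  \<comment> \<open>Two exchanges, \<open>a\<close> for \<open>a + x\<close> and then
    \<open>a + x\<close> for \<open>a + 1 + r\<close>, change the divided difference in the same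
    direction. Together they move the progression by one step, so \<open>x * T\<close> is bounded by
    the whole change.\<close>
  have "(a + x - a) * T = dd f (insert (a + x) B) - dd f (insert a B)"
    unfolding T_def using notin x B by (intro dd_recursion) auto
  then have xT: "x * T = dd f (insert (a + x) B) - dd f (insert a B)" by simp
  have "(a + 1 + real r - (a + x)) * dd f (insert (a + 1 + real r) (insert (a + x) B))
      = dd f (insert (a + 1 + real r) B) - dd f (insert (a + x) B)"
    using notin x B by (intro dd_recursion) auto
  moreover have "0 \<le> (a + 1 + real r - (a + x)) * (s * dd f (insert (a + 1 + real r) (insert (a + x) B)))"
    using notin x B by (intro mult_nonneg_nonneg convex) auto
  ultimately have "0 \<le> s * (dd f (insert (a + 1 + real r) B) - dd f (insert (a + x) B))"
    by (simp only: mult.left_commute)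
  then have "s * (x * T) \<le> s * (dd f (insert (a + 1 + real r) B) - dd f (insert a B))"
    unfolding xT by (simp add: algebra_simps)
  also have "dd f (insert (a + 1 + real r) B) - dd f (insert a B) = (fdiff ^^ Suc r) f a / fact r"
    unfolding A[symmetric] A'[symmetric] dd_arith_progression by (simp add: fdiff_def diff_divide_distrib)
  finally have up: "s * (x * T) \<le> s * ((fdiff ^^ Suc r) f a / fact r)" .
  have "0 \<le> x * (s * T)" unfolding T_def using notin x B by (intro mult_nonneg_nonneg convex) auto
  then have "0 \<le> s * (x * T)" by (simp only: mult.left_commute)
  moreover have "\<bar>u\<bar> \<le> \<bar>v\<bar>" if "0 \<le> s * u" "s * u \<le> s * v" for u v using that s by auto
  ultimately have "\<bar>x * T\<bar> \<le> \<bar>(fdiff ^^ Suc r) f a / fact r\<bar>" using up by blast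
  then have "x * \<bar>T\<bar> \<le> \<bar>(fdiff ^^ Suc r) f a\<bar> / fact r" using x by (simp add: abs_mult)
  then have Tb: "\<bar>T\<bar> \<le> \<bar>(fdiff ^^ Suc r) f a\<bar> / fact r / x"
    unfolding pos_le_divide_eq[OF x(1)] by (simp only: mult.commute)
  have "a + x \<notin> (\<lambda>j. a + real j) ` {..<Suc r}"
    unfolding lessThan_Suc_atMost A using notin x by auto
  from newton_remainder[OF this, of f]
  have "f (a + x) - (\<Sum>k\<le>r. (x gchoose k) * (fdiff ^^ k) f a) = (\<Prod>j\<le>r. x - real j) * T"
    unfolding lessThan_Suc_atMost A T_def by simp
  then have "\<bar>f (a + x) - (\<Sum>k\<le>r. (x gchoose k) * (fdiff ^^ k) f a)\<bar> = \<bar>\<Prod>j\<le>r. x - real j\<bar> * \<bar>T\<bar>"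
    by (simp only: abs_mult)
  also have "\<dots> \<le> \<bar>\<Prod>j\<le>r. x - real j\<bar> * (\<bar>(fdiff ^^ Suc r) f a\<bar> / fact r / x)"
    using Tb by (rule mult_left_mono) simp
  finally show ?thesis by (simp add: mult.commute)
qed

text \<open>The error at order \<open>r\<close> is controlled by \<open>(fdiff ^^ Suc r) f\<close>,
  which is \<open>(fdiff ^^ r) g\<close> and vanishes at infinity. Every further term vanishes
  likewise, which permits any larger order \<open>k\<close> and so makes solutions from different
  classes comparable.\<close>

lemma K_class_interpolation_limit:
  assumes f: "f \<in> K_class r" and fg: "\<And>x. 0 < x \<Longrightarrow> fdiff f x = g x"
    and g: "g \<in> D_class r" and x: "0 < x" "x < 1" and k: "r \<le> k"
  shows "(\<lambda>n. f (real n + x) - (\<Sum>j\<le>k. (x gchoose j) * (fdiff ^^ j) f (real n))) \<longlonglongrightarrow> 0"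
  using k
proof (induction rule: dec_induct)
  case base
  obtain J s where J: "right_unbounded_subinterval J" and s: "s = 1 \<or> s = -1"
    and convex: "\<And>X. finite X \<Longrightarrow> card X = r + 2 \<Longrightarrow> X \<subseteq> J \<Longrightarrow> 0 \<le> s * dd f X"
    using f unfolding K_class_iff_dd by blast
  obtain c where c: "0 < c" "{c..} \<subseteq> J" using right_unbounded_subintervalE[OF J] .
  obtain N where N: "c \<le> real N" using real_arch_simple by blast
  show ?case
  proof (rule Lim_null_comparison)
    show "\<forall>\<^sub>F n in sequentially. norm (f (real n + x) - (\<Sum>j\<le>r. (x gchoose j) * (fdiff ^^ j) f (real n)))
      \<le> \<bar>\<Prod>j\<le>r. x - real j\<bar> / x * (\<bar>(fdiff ^^ r) g (real n)\<bar> / fact r)"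
      using eventually_ge_at_top[of N]
    proof eventually_elim
      case (elim n)
      then have n: "c \<le> real n" using N by (meson of_nat_le_iff order_trans)
      then have "{real n..} \<subseteq> J" using c by auto
      then have "0 \<le> s * dd f X" if "finite X" "card X = r + 2" "X \<subseteq> {real n..}" for X
        using convex that by blast
      from K_class_interpolation_bound[OF this s x]
      have "\<bar>f (real n + x) - (\<Sum>k\<le>r. (x gchoose k) * (fdiff ^^ k) f (real n))\<bar>
        \<le> \<bar>\<Prod>j\<le>r. x - real j\<bar> / x * (\<bar>(fdiff ^^ Suc r) f (real n)\<bar> / fact r)" by blast
      moreover have "(fdiff ^^ Suc r) f (real n) = (fdiff ^^ r) g (real n)"
        using n c(1) by (intro funpow_fdiff_Suc fg) auto
      ultimately show ?case by (simp only: real_norm_def)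
    qed
    have "(\<lambda>n. (fdiff ^^ r) g (real n)) \<longlonglongrightarrow> 0" using g by (simp add: D_class_def)
    then show "(\<lambda>n. \<bar>\<Prod>j\<le>r. x - real j\<bar> / x * (\<bar>(fdiff ^^ r) g (real n)\<bar> / fact r)) \<longlonglongrightarrow> 0"
      by (intro tendsto_mult_right_zero tendsto_divide_zero tendsto_rabs_zero)
  qed
next
  case (step k)
  have "(\<lambda>n. (fdiff ^^ k) g (real n)) \<longlonglongrightarrow> 0"
    using D_class_mono[OF g step.hyps(1)] by (simp add: D_class_def)
  moreover have "\<forall>\<^sub>F n in sequentially. (fdiff ^^ k) g (real n) = (fdiff ^^ Suc k) f (real n)"
    using eventually_gt_at_top[of 0] by eventually_elim (rule funpow_fdiff_Suc[OF fg, symmetric], auto)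
  ultimately have "(\<lambda>n. (fdiff ^^ Suc k) f (real n)) \<longlonglongrightarrow> 0"
    by (rule Lim_transform_eventually)
  from tendsto_diff[OF step.IH tendsto_mult_right_zero[OF this, of "x gchoose Suc k"]]
  show ?case by (simp add: algebra_simps)
qed

text \<open>The difference of two solutions has period 1. Far out, both are approximated on a unit
  interval by the same interpolation formula, since their differences of order at least 1 come from
  \<open>g\<close>; so the constant difference along \<open>n + y\<close> tends to 0.\<close>

lemma K_class_solution_unique:
  assumes f1: "f1 \<in> K_class r1" "\<And>x. 0 < x \<Longrightarrow> fdiff f1 x = g x" "g \<in> D_class r1" "f1 1 = 0"
    and f2: "f2 \<in> K_class r2" "\<And>x. 0 < x \<Longrightarrow> fdiff f2 x = g x" "g \<in> D_class r2" "f2 1 = 0"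
    and "0 < x"
  shows "f1 x = f2 x"
proof -
  have shift: "f1 (y + 1) - f2 (y + 1) = f1 y - f2 y" if "0 < y" for y
    using f1(2)[OF that] f2(2)[OF that] by (simp add: fdiff_def)
  have shift_nat: "f1 (real n + y) - f2 (real n + y) = f1 y - f2 y" if "0 < y" for y n
  proof (induction n)
    case (Suc n)
    then show ?case using shift[of "real n + y"] that by (simp add: add_ac)
  qed simp
  have unit: "f1 y = f2 y" if y: "0 < y" "y < 1" for y
  proof -
    define k where "k = max r1 r2"
    let ?L = "\<lambda>f n. f (real n + y) - (\<Sum>j\<le>k. (y gchoose j) * (fdiff ^^ j) f (real n))"
    have "(\<lambda>n. ?L f1 n - ?L f2 n) \<longlonglongrightarrow> 0 - 0"
      using K_class_interpolation_limit[OF f1(1-3) y, of k] K_class_interpolation_limit[OF f2(1-3) y, of k]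
      by (intro tendsto_diff) (auto simp: k_def)
    moreover have "\<forall>\<^sub>F n in sequentially. ?L f1 n - ?L f2 n = f1 y - f2 y"
      using eventually_gt_at_top[of 0]
    proof eventually_elim
      case (elim n)
      have "(fdiff ^^ j) f1 (real n) = (fdiff ^^ j) f2 (real n)" for j
      proof (cases j)
        case 0
        \<comment> \<open>Order 0 is the only one not given by \<open>g\<close>; here the common
          value at 1 is transported to \<open>n\<close>.\<close>
        have "f1 (real (n - 1) + 1) - f2 (real (n - 1) + 1) = 0" using shift_nat[of 1 "n - 1"] f1(4) f2(4) by simp
        then show ?thesis using 0 elim by (simp add: of_nat_diff)
      next
        case (Suc i)
        have "(fdiff ^^ Suc i) f1 (real n) = (fdiff ^^ i) g (real n)" "(fdiff ^^ Suc i) f2 (real n) = (fdiff ^^ i) g (real n)"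
          using elim by (auto intro!: funpow_fdiff_Suc f1(2) f2(2) simp del: funpow.simps)
        then show ?thesis using Suc by simp
      qed
      then show ?case using shift_nat[OF y(1), of n] by simp
    qed
    ultimately have "(\<lambda>n. f1 y - f2 y) \<longlonglongrightarrow> 0"
      using Lim_transform_eventually by fastforce
    then show ?thesis by (simp add: LIMSEQ_const_iff)
  qed
  have "f1 y = f2 y" if "0 < y" "y \<le> real (Suc n)" for y n
    using that
  proof (induction n arbitrary: y)
    case 0
    then show ?case using unit f1(4) f2(4) by (cases "y = 1") auto
  next
    case (Suc n)
    show ?case
    proof (cases "y \<le> 1")
      case True
      then show ?thesis using unit f1(4) f2(4) Suc.prems by (cases "y = 1") auto
    next
      case False
      then show ?thesis using Suc.IH[of "y - 1"] Suc.prems shift[of "y - 1"] by simp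
    qed
  qed
  moreover obtain n where "x \<le> real n" using real_arch_simple by blast
  then have "x \<le> real (Suc n)" by simp
  ultimately show ?thesis using \<open>0 < x\<close> by blast
qed

text \<open>By the mean value theorem on a progression, the \<open>m\<close>th difference at
  \<open>n\<close> equals \<open>D m\<close> at some point beyond \<open>n\<close>.\<close>

lemma D_class_of_deriv_tendsto_0:
  assumes D: "deriv_seq D" and lim: "(D m \<longlongrightarrow> 0) at_top"
  shows "D 0 \<in> D_class m"
  unfolding D_class_def mem_Collect_eq
proof (rule tendstoI)
  fix e :: real assume "0 < e"
  with lim have "eventually (\<lambda>x. dist (D m x) 0 < e) at_top" by (rule tendstoD)
  then obtain b where b: "\<And>x. b \<le> x \<Longrightarrow> dist (D m x) 0 < e" by (auto simp: eventually_at_top_linorder)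
  obtain N where N: "max b 1 \<le> real N" using real_arch_simple by blast
  show "\<forall>\<^sub>F n in sequentially. dist ((fdiff ^^ m) (D 0) (real n)) 0 < e"
    using eventually_ge_at_top[of N]
  proof eventually_elim
    case (elim n)
    then have n: "max b 1 \<le> real n" using N by (meson of_nat_le_iff order_trans)
    let ?A = "(\<lambda>j. real n + real j) ` {..m}"
    have "\<exists>\<xi>. real n \<le> \<xi> \<and> \<xi> \<le> real n + real m \<and> dd (D 0) ?A = D m \<xi> / fact m"
      using n by (intro dd_mean_value deriv_seqD[OF D]) (auto simp: card_image inj_on_def)
    then obtain \<xi> where "real n \<le> \<xi>" "(fdiff ^^ m) (D 0) (real n) = D m \<xi>"
      unfolding dd_arith_progression by auto
    then show ?case using b[of \<xi>] n by simp
  qed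
qed

lemma K_class_of_deriv_sign:
  assumes D: "deriv_seq D" and f: "\<And>x. 0 < x \<Longrightarrow> f x = D 0 x" and s: "s = 1 \<or> s = -1"
    and sg: "\<And>x. 0 < x \<Longrightarrow> 0 \<le> s * D (Suc r) x"
  shows "f \<in> K_class r"
  unfolding K_class_iff_dd
proof (intro exI conjI allI impI)
  show "right_unbounded_subinterval {0<..}" by (rule right_unbounded_greaterThan) simp
  show "0 \<le> s * dd f X" if "finite X \<and> card X = r + 2 \<and> X \<subseteq> {0<..}" for X
    using that by (intro dd_sign_of_deriv_sign[OF D f _ _ _ order_refl sg]) auto
qed (rule s)

section \<open>Construction of the principal solution\<close>

text \<open>The absolute value of \<open>E (Suc n)\<close> decreases, so its value at the right end
  of a unit interval is at most the drop of the absolute value of \<open>E n\<close> there; these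
  drops telescope.\<close>

lemma alternating_telescoping:
  assumes E: "deriv_seq E" and sg: "\<And>n x. 0 < x \<Longrightarrow> 0 \<le> s * (-1) ^ n * E n x" and s: "s = 1 \<or> s = -1"
    and x: "0 < x"
  shows "summable (\<lambda>k. E (Suc n) (x + real k))"
    and "\<bar>\<Sum>k. E (Suc n) (x + 1 + real k)\<bar> \<le> \<bar>E n x\<bar>"
proof -
  define t where "t = s * (-1) ^ n"
  have t: "t = 1 \<or> t = -1" using s by (auto simp: t_def minus_one_power_iff)
  have E0: "0 \<le> t * E n y" and E1: "0 \<le> - t * E (Suc n) y" and E2: "0 \<le> t * E (Suc (Suc n)) y" if "0 < y" for y
    using sg[OF that, of n] sg[OF that, of "Suc n"] sg[OF that, of "Suc (Suc n)"] by (simp_all add: t_def)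
  \<comment> \<open>The shift by 1 selects right end points; the sum from \<open>x\<close> itself
    has just one more term.\<close>
  define v where "v k = - t * E (Suc n) (x + 1 + real k)" for k
  have v0: "0 \<le> v k" for k using E1[of "x + 1 + real k"] x by (simp add: v_def)
  have vle: "v k \<le> t * E n (x + real k) - t * E n (x + real (Suc k))" for k
  proof -
    have "0 < x + real k" "x + real k < x + real k + 1" using x by auto
    from deriv_seq_mean_value[OF E this, of n]
    obtain z where z: "x + real k < z" "z < x + real k + 1"
      "E n (x + real k + 1) - E n (x + real k) = (x + real k + 1 - (x + real k)) * E (Suc n) z" .
    have "t * E (Suc n) z \<le> t * E (Suc n) (x + real k + 1)"
      using deriv_seq_signed_mono[OF E order_refl E2, of z "x + real k + 1"] z x by simp
    moreover have "t * E n (x + real k + 1) - t * E n (x + real k) = t * E (Suc n) z"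
      using z(3) by (simp add: right_diff_distrib[symmetric])
    ultimately show ?thesis by (simp add: v_def add_ac)
  qed
  have partial: "(\<Sum>k<m. v k) \<le> t * E n x" for m
  proof -
    have "(\<Sum>k<m. v k) \<le> (\<Sum>k<m. t * E n (x + real k) - t * E n (x + real (Suc k)))"
      by (intro sum_mono vle)
    also have "\<dots> = t * E n x - t * E n (x + real m)"
      by (subst sum_lessThan_telescope') simp
    also have "\<dots> \<le> t * E n x" using E0[of "x + real m"] x by simp
    finally show ?thesis .
  qed
  have sv: "summable v" by (rule summableI_nonneg_bounded[OF v0 partial])
  have vE: "E (Suc n) (x + 1 + real k) = - t * v k" for k using t by (auto simp: v_def)
  have "summable (\<lambda>k. E (Suc n) (x + 1 + real k))" unfolding vE by (rule summable_mult[OF sv])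
  then show "summable (\<lambda>k. E (Suc n) (x + real k))"
    by (subst summable_Suc_iff[symmetric]) (simp add: add_ac)
  have "\<bar>\<Sum>k. E (Suc n) (x + 1 + real k)\<bar> = \<bar>- t * suminf v\<bar>" unfolding vE suminf_mult[OF sv] ..
  also have "\<dots> = suminf v" using t suminf_nonneg[OF sv v0] by auto
  also have "\<dots> \<le> t * E n x" by (rule suminf_le_const[OF sv partial])
  also have "\<dots> = \<bar>E n x\<bar>" using E0[OF x] t by auto
  finally show "\<bar>\<Sum>k. E (Suc n) (x + 1 + real k)\<bar> \<le> \<bar>E n x\<bar>" .
qed

text \<open>The minus sign in \<open>S\<close> orients the telescoping and also gives
  \<open>S n\<close> the sign of \<open>E n\<close>. The tail bound by \<open>E n (x - 1)\<close>
  yields the limits.\<close>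

lemma alternating_difference_equation:
  assumes E: "deriv_seq E" and sg: "\<And>n x. 0 < x \<Longrightarrow> 0 \<le> s * (-1) ^ n * E n x" and s: "s = 1 \<or> s = -1"
    and lim: "\<And>n. (E n \<longlongrightarrow> 0) at_top"
  obtains S where "deriv_seq S" "\<And>n x. 0 < x \<Longrightarrow> S n (x + 1) - S n x = E (Suc n) x"
    "\<And>n x. 0 < x \<Longrightarrow> 0 \<le> s * (-1) ^ n * S n x" "\<And>n. (S n \<longlongrightarrow> 0) at_top"
proof
  define S where "S n x = - (\<Sum>k. E (Suc n) (x + real k))" for n x
  have summable: "summable (\<lambda>k. E (Suc n) (x + real k))"
    and tail: "\<bar>\<Sum>k. E (Suc n) (x + 1 + real k)\<bar> \<le> \<bar>E n x\<bar>" if "0 < x" for n x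
    using alternating_telescoping[OF E sg s that] by blast+
  show "deriv_seq S"
    unfolding deriv_seq_def
  proof (intro allI impI)
    fix n and x :: real assume x: "0 < x"
    \<comment> \<open>Termwise differentiation takes place to the right of \<open>c\<close>, where
      monotonicity bounds each term of the derived series by its value at \<open>c\<close>.\<close>
    define c where "c = x / 2"
    have c: "0 < c" "c < x" using x by (auto simp: c_def)
    define t where "t = s * (-1) ^ n"
    have t: "t = 1 \<or> t = -1" using s by (auto simp: t_def minus_one_power_iff)
    have E23: "0 \<le> t * E (Suc (Suc n)) y \<and> 0 \<le> - t * E (Suc (Suc (Suc n))) y" if "0 < y" for y
      using sg[OF that, of "Suc (Suc n)"] sg[OF that, of "Suc (Suc (Suc n))"] by (simp add: t_def)
    have dom: "\<bar>E (Suc (Suc n)) (y + real k)\<bar> \<le> \<bar>E (Suc (Suc n)) (c + real k)\<bar>" if "c < y" for y k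
    proof -
      have "- t * E (Suc (Suc n)) (c + real k) \<le> - t * E (Suc (Suc n)) (y + real k)"
        using deriv_seq_signed_mono[OF E order_refl, of "- t" "Suc (Suc n)" "c + real k" "y + real k"] E23 c that by auto
      moreover have "0 \<le> t * E (Suc (Suc n)) (y + real k)" using E23[of "y + real k"] c that by simp
      ultimately show ?thesis using t by auto
    qed
    have sm: "summable (\<lambda>k. \<bar>E (Suc (Suc n)) (c + real k)\<bar>)"
    proof -
      have "\<bar>E (Suc (Suc n)) (c + real k)\<bar> = t * E (Suc (Suc n)) (c + real k)" for k
        using E23[of "c + real k"] c t by auto
      then show ?thesis using summable_mult[OF summable[OF c(1)], of t] by simp
    qed
    have uc: "uniformly_convergent_on {c<..} (\<lambda>m y. \<Sum>k<m. E (Suc (Suc n)) (y + real k))"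
      by (rule Weierstrass_m_test'[OF _ sm]) (use dom in auto)
    have "((\<lambda>y. \<Sum>k. E (Suc n) (y + real k)) has_real_derivative (\<Sum>k. E (Suc (Suc n)) (x + real k))) (at x)"
    proof (rule has_field_derivative_series'(2)[OF _ _ uc])
      show "(((\<lambda>y. E (Suc n) (y + real k)) has_real_derivative E (Suc (Suc n)) (y + real k)) (at y within {c<..}))"
        if "y \<in> {c<..}" for k y
      proof -
        have "(E (Suc n) has_real_derivative E (Suc (Suc n)) (y + real k)) (at (y + real k))"
          using that c by (intro deriv_seqD[OF E]) simp
        then show ?thesis by (simp add: DERIV_shift has_field_derivative_at_within)
      qed
      show "summable (\<lambda>k. E (Suc n) (x + real k))" by (rule summable[OF x])
      show "x \<in> {c<..}" "x \<in> interior {c<..}" using c by (auto simp: interior_open)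
    qed auto
    from DERIV_minus[OF this]
    show "(S n has_real_derivative S (Suc n) x) (at x)" by (simp add: S_def[abs_def])
  qed
  have split: "(\<Sum>k. E (Suc n) (x + real k)) = E (Suc n) x + (\<Sum>k. E (Suc n) (x + 1 + real k))" if "0 < x" for n x
    using suminf_split_head[OF summable[OF that, of n]] by (simp add: add_ac)
  show "S n (x + 1) - S n x = E (Suc n) x" if "0 < x" for n x
    using split[OF that, of n] by (simp add: S_def)
  show "0 \<le> s * (-1) ^ n * S n x" if x: "0 < x" for n x
  proof -
    have "0 \<le> (\<Sum>k. s * (-1) ^ Suc n * E (Suc n) (x + real k))"
      by (intro suminf_nonneg summable_mult summable x sg) (use x in simp)
    then show ?thesis using suminf_mult[OF summable[OF x, of n], of "s * (-1) ^ Suc n"] by (simp add: S_def)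
  qed
  show "(S n \<longlongrightarrow> 0) at_top" for n
  proof (rule Lim_null_comparison)
    show "\<forall>\<^sub>F x in at_top. norm (S n x) \<le> \<bar>E n (x - 1)\<bar>"
      using eventually_gt_at_top[of 1]
    proof eventually_elim
      case (elim x)
      then show ?case using tail[of "x - 1" n] by (simp add: S_def)
    qed
    have "filterlim (\<lambda>x::real. x - 1) at_top at_top"
      using filterlim_tendsto_add_at_top[OF tendsto_const[of "-1::real" at_top] filterlim_ident] by simp
    then show "((\<lambda>x. \<bar>E n (x - 1)\<bar>) \<longlongrightarrow> 0) at_top"
      using filterlim_compose[OF lim[of n]] tendsto_rabs_zero by blast
  qed
qed

section \<open>Integrating the difference equation\<close>

lemma deriv_seq_antiderivative:
  assumes D: "deriv_seq D"
  obtains \<Phi> where "deriv_seq (case_nat \<Phi> D)"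
proof -
  have "\<exists>F. \<forall>x. 0 < ereal x \<longrightarrow> ereal x < \<infinity> \<longrightarrow> (F has_vector_derivative D 0 x) (at x)"
    using deriv_seqD[OF D] by (intro einterval_antiderivative) (auto intro: DERIV_isCont)
  then obtain \<Phi> where "\<And>x. 0 < x \<Longrightarrow> (\<Phi> has_real_derivative D 0 x) (at x)"
    by (auto simp: has_real_derivative_iff_has_vector_derivative)
  then have "deriv_seq (case_nat \<Phi> D)"
    using deriv_seqD[OF D] by (auto simp: deriv_seq_def split: nat.split)
  then show ?thesis by (rule that)
qed

lemma deriv_shift_plus_1:
  assumes D: "deriv_seq D" and "0 < x"
  shows "((\<lambda>y. D n (y + 1) - D n y) has_real_derivative D (Suc n) (x + 1) - D (Suc n) x) (at x)"
  using deriv_seqD[OF D, of x n] deriv_seqD[OF D, of "x + 1" n] \<open>0 < x\<close>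
  by (intro DERIV_diff) (simp_all add: DERIV_shift)

lemma difference_equation_antiderivative:
  assumes D: "deriv_seq D" and G: "deriv_seq G"
    and eq: "\<And>x. 0 < x \<Longrightarrow> D (Suc 0) (x + 1) - D (Suc 0) x = G (Suc 0) x"
  obtains c where "\<And>x. 0 < x \<Longrightarrow> D 0 (x + 1) - D 0 x = G 0 x + c"
proof -
  have "((\<lambda>y. (D 0 (y + 1) - D 0 y) - G 0 y) has_real_derivative 0) (at x)" if "0 < x" for x
    using DERIV_diff[OF deriv_shift_plus_1[OF D that, of 0] deriv_seqD[OF G that, of 0]] eq[OF that] by simp
  then have "\<exists>c. \<forall>x\<in>{0<..}. (D 0 (x + 1) - D 0 x) - G 0 x = c"
    by (intro has_field_derivative_zero_constant) (auto intro: has_field_derivative_at_within)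
  then obtain c where c: "\<And>x. 0 < x \<Longrightarrow> (D 0 (x + 1) - D 0 x) - G 0 x = c" by auto
  show ?thesis
  proof (rule that)
    show "D 0 (x + 1) - D 0 x = G 0 x + c" if "0 < x" for x using c[OF that] by simp
  qed
qed

lemma difference_equation_derivs:
  assumes D: "deriv_seq D" and G: "deriv_seq G"
    and eq: "\<And>x. 0 < x \<Longrightarrow> D 0 (x + 1) - D 0 x = G 0 x" and "0 < x"
  shows "D n (x + 1) - D n x = G n x"
  using \<open>0 < x\<close>
proof (induction n arbitrary: x)
  case (Suc n)
  have "((\<lambda>y. D n (y + 1) - D n y) has_real_derivative G (Suc n) x) (at x)"
    by (rule has_field_derivative_transform_within_open[OF deriv_seqD[OF G Suc.prems], of "{0<..}"])
      (use Suc in auto)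
  then show ?case using DERIV_unique deriv_shift_plus_1[OF D Suc.prems] by blast
qed (rule eq)

lemma tendsto_0_difference_of_deriv:
  assumes D: "deriv_seq D" and lim: "(D (Suc n) \<longlongrightarrow> 0) at_top"
  shows "((\<lambda>x. D n (x + 1) - D n x) \<longlongrightarrow> 0) at_top"
proof (rule tendstoI)
  fix e :: real assume "0 < e"
  with lim have "eventually (\<lambda>x. dist (D (Suc n) x) 0 < e) at_top" by (rule tendstoD)
  then obtain b where b: "\<And>x. b \<le> x \<Longrightarrow> dist (D (Suc n) x) 0 < e" by (auto simp: eventually_at_top_linorder)
  show "\<forall>\<^sub>F x in at_top. dist (D n (x + 1) - D n x) 0 < e"
    using eventually_gt_at_top[of "max b 0"]
  proof eventually_elim
    case (elim x)
    then have "0 < x" "x < x + 1" by auto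
    from deriv_seq_mean_value[OF D this, of n]
    obtain z where "x < z" "D n (x + 1) - D n x = (x + 1 - x) * D (Suc n) z" .
    then show ?case using b[of z] elim by simp
  qed
qed

text \<open>The constant of integration is the limit of the difference of two functions that tend to
  0, so it vanishes. No correction is made, and \<open>D 0\<close> keeps its sign and limit as the
  derivative of \<open>D' 0\<close>.\<close>

lemma difference_equation_lower_base:
  assumes D: "deriv_seq D" and G: "deriv_seq G"
    and eq: "\<And>x. 0 < x \<Longrightarrow> D 0 (x + 1) - D 0 x = G (Suc 0) x"
    and lim: "(D 0 \<longlongrightarrow> 0) at_top" "(G 0 \<longlongrightarrow> 0) at_top"
  obtains D' where "deriv_seq D'" "\<And>x. 0 < x \<Longrightarrow> D' 0 (x + 1) - D' 0 x = G 0 x" "\<And>n. D' (Suc n) = D n"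
proof -
  obtain \<Phi> where \<Phi>: "deriv_seq (case_nat \<Phi> D)" using deriv_seq_antiderivative[OF D] .
  obtain c where c: "\<And>x. 0 < x \<Longrightarrow> \<Phi> (x + 1) - \<Phi> x = G 0 x + c"
    using difference_equation_antiderivative[OF \<Phi> G] eq by auto
  have "((\<lambda>x. \<Phi> (x + 1) - \<Phi> x) \<longlongrightarrow> 0) at_top"
    using tendsto_0_difference_of_deriv[OF \<Phi>, of 0] lim(1) by simp
  from tendsto_diff[OF this lim(2)] have "((\<lambda>x. \<Phi> (x + 1) - \<Phi> x - G 0 x) \<longlongrightarrow> 0) at_top" by simp
  moreover have "\<forall>\<^sub>F x in at_top. \<Phi> (x + 1) - \<Phi> x - G 0 x = c"
    using eventually_gt_at_top[of 0] by eventually_elim (use c in auto)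
  ultimately have "((\<lambda>x::real. c) \<longlongrightarrow> 0) at_top" by (rule Lim_transform_eventually)
  then have "c = 0" by (simp add: tendsto_const_iff)
  then show ?thesis using that[OF \<Phi>] c by simp
qed

text \<open>An antiderivative solves the equation up to a constant, which a linear term absorbs; this changes
  the first derivative by a constant and leaves all higher ones alone.\<close>

lemma difference_equation_lower_step:
  assumes D: "deriv_seq D" and G: "deriv_seq G"
    and eq: "\<And>x. 0 < x \<Longrightarrow> D 0 (x + 1) - D 0 x = G (Suc 0) x"
  obtains D' where "deriv_seq D'" "\<And>x. 0 < x \<Longrightarrow> D' 0 (x + 1) - D' 0 x = G 0 x"
    "\<And>n. D' (Suc (Suc n)) = D (Suc n)"
proof -
  obtain \<Phi> where \<Phi>: "deriv_seq (case_nat \<Phi> D)" using deriv_seq_antiderivative[OF D] .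
  obtain c where c: "\<And>x. 0 < x \<Longrightarrow> \<Phi> (x + 1) - \<Phi> x = G 0 x + c"
    using difference_equation_antiderivative[OF \<Phi> G] eq by auto
  define D' where "D' = case_nat (\<lambda>x. \<Phi> x - c * x) (case_nat (\<lambda>x. D 0 x - c) (\<lambda>n. D (Suc n)))"
  show ?thesis
  proof
    show "deriv_seq D'"
      unfolding deriv_seq_def
    proof (intro allI impI)
      fix n and x :: real assume x: "0 < x"
      show "(D' n has_real_derivative D' (Suc n) x) (at x)"
      proof (cases n)
        case 0
        have "(\<Phi> has_real_derivative D 0 x) (at x)" using deriv_seqD[OF \<Phi> x, of 0] by simp
        then have "((\<lambda>x. \<Phi> x - c * x) has_real_derivative D 0 x - c) (at x)"
          by (auto intro!: derivative_eq_intros)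
        then show ?thesis by (simp add: D'_def 0)
      next
        case (Suc m)
        have "((\<lambda>x. D 0 x - c) has_real_derivative D (Suc 0) x) (at x)"
          using deriv_seqD[OF D x, of 0] by (auto intro!: derivative_eq_intros)
        then show ?thesis using deriv_seqD[OF D x] by (simp add: D'_def Suc split: nat.split)
      qed
    qed
    show "D' 0 (x + 1) - D' 0 x = G 0 x" if "0 < x" for x
      using c[OF that] by (simp add: D'_def algebra_simps)
    show "D' (Suc (Suc n)) = D (Suc n)" for n by (simp add: D'_def)
  qed
qed

text \<open>The last equation starts at \<open>Suc n\<close> because a correction may shift
  \<open>D 0\<close> by a constant; what survives all \<open>j\<close> steps are the derivatives of
  order above \<open>j\<close>.\<close>

lemma difference_equation_lower:
  assumes G: "deriv_seq G" and D: "deriv_seq D"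
    and eq: "\<And>x. 0 < x \<Longrightarrow> D 0 (x + 1) - D 0 x = G j x"
  shows "\<exists>D'. deriv_seq D' \<and> (\<forall>x>0. D' 0 (x + 1) - D' 0 x = G 0 x) \<and> (\<forall>n. D' (Suc n + j) = D (Suc n))"
  using D eq
proof (induction j arbitrary: D)
  case 0
  then show ?case by auto
next
  case (Suc j)
  obtain D1 where D1: "deriv_seq D1" "\<And>x. 0 < x \<Longrightarrow> D1 0 (x + 1) - D1 0 x = G j x"
    "\<And>n. D1 (Suc (Suc n)) = D (Suc n)"
    using difference_equation_lower_step[OF Suc.prems(1) deriv_seq_shift[OF G, of j]] Suc.prems(2) by auto
  from Suc.IH[OF D1(1,2)] obtain D' where D': "deriv_seq D'" "\<forall>x>0. D' 0 (x + 1) - D' 0 x = G 0 x"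
    "\<And>n. D' (Suc n + j) = D1 (Suc n)" by blast
  have "D' (Suc n + Suc j) = D (Suc n)" for n using D'(3)[of "Suc n"] D1(3)[of n] by simp
  with D' show ?case by blast
qed

section \<open>From the constructed solution to \<open>Sigma_fun\<close>\<close>

lemma eventually_tends_monotonically_to_zero_cong:
  assumes eq: "\<And>x. 0 < x \<Longrightarrow> u x = v x" and v: "eventually_tends_monotonically_to_zero v"
  shows "eventually_tends_monotonically_to_zero u"
proof -
  have "\<forall>\<^sub>F x in at_top. v x = u x"
    using eventually_gt_at_top[of 0] by eventually_elim (use eq in auto)
  then have "(u \<longlongrightarrow> 0) at_top"
    using v Lim_transform_eventually unfolding eventually_tends_monotonically_to_zero_def by blast
  moreover obtain J where J: "right_unbounded_subinterval J" "mono_on J v \<or> antimono_on J v"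
    using v by (auto simp: eventually_tends_monotonically_to_zero_def)
  have "\<And>x. x \<in> J \<Longrightarrow> u x = v x" using J(1) eq by (auto simp: right_unbounded_subinterval_def)
  then have "mono_on J u \<or> antimono_on J u" using J(2) by (auto simp: monotone_on_def)
  ultimately show ?thesis using J(1) by (auto simp: eventually_tends_monotonically_to_zero_def)
qed

text \<open>A competitor \<open>h\<close> brings its own \<open>r'\<close>, so uniqueness across
  classes is what applies; extensionality turns agreement on the half-line into equality.\<close>

lemma Sigma_fun_eqI:
  assumes "g \<in> D_class r" "g \<in> K_class r" and f: "f \<in> K_class r" "f \<in> extensional {0<..}" "f 1 = 0"
    and eq: "\<And>x. 0 < x \<Longrightarrow> fdiff f x = g x"
  shows "Sigma_fun g = f"
  unfolding Sigma_fun_def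
proof (rule the_equality)
  show "f \<in> extensional {0<..} \<and> (\<exists>r. g \<in> D_class r \<inter> K_class r \<and> f \<in> K_class r) \<and> f 1 = 0 \<and> (\<forall>x>0. fdiff f x = g x)"
    using assms by blast
next
  fix h assume "h \<in> extensional {0<..} \<and> (\<exists>r. g \<in> D_class r \<inter> K_class r \<and> h \<in> K_class r) \<and> h 1 = 0 \<and> (\<forall>x>0. fdiff h x = g x)"
  then obtain r' where h: "h \<in> extensional {0<..}" "h \<in> K_class r'" "g \<in> D_class r'" "h 1 = 0"
    "\<And>x. 0 < x \<Longrightarrow> fdiff h x = g x" by blast
  show "h = f"
  proof (rule extensionalityI[OF h(1) f(2)])
    show "h x = f x" if "x \<in> {0<..}" for x
      using K_class_solution_unique[OF h(2,5,3,4) f(1) eq assms(1) f(3)] that by simp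
  qed
qed

theorem theorem4p5:
  fixes p q :: nat and g :: "real \<Rightarrow> real"
  assumes "p < q"
    and "infinitely_differentiable_on g {0<..}"
    and "eventually_tends_monotonically_to_zero ((deriv ^^ p) g)"
    and "regularly_monotone_on ((deriv ^^ q) g) {0<..}"
  shows "Sigma_exists g \<and>
    infinitely_differentiable_on (Sigma_fun g) {0<..} \<and>
    (\<forall>n\<ge>p + 1. eventually_tends_monotonically_to_zero ((deriv ^^ n) (Sigma_fun g))) \<and>
    ((completely_monotone_on ((deriv ^^ (q - 1)) g) {0<..} \<and>
      completely_monotone_on ((deriv ^^ q) (Sigma_fun g)) {0<..}) \<or>
     (completely_monotone_on (\<lambda>x. - (deriv ^^ (q - 1)) g x) {0<..} \<and>
      completely_monotone_on (\<lambda>x. - (deriv ^^ q) (Sigma_fun g) x) {0<..})) \<and>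
    real_analytic_on (Sigma_fun g) {0<..} \<and>
    (\<forall>a>0. admits_newton_series (Sigma_fun g) {0<..} a)"
proof -
  define G where "G n = (deriv ^^ n) g" for n
  obtain m where m: "q = Suc m" "p \<le> m" using assms(1) by (cases q) auto
  have G: "deriv_seq G" unfolding G_def using assms(2) by (rule deriv_seq_higher_deriv)
  have G0: "G 0 = g" by (simp add: G_def)
  have Gp: "(G p \<longlongrightarrow> 0) at_top"
    using assms(3) by (simp add: G_def eventually_tends_monotonically_to_zero_def)
  have Gq: "(\<forall>x>0. 0 \<le> G (n + q) x) \<or> (\<forall>x>0. G (n + q) x \<le> 0)" for n
    using assms(4) by (force simp: regularly_monotone_on_def G_def funpow_add)
  have "eventually_signed (G n)" if "q \<le> n" for n
  proof -
    have "(\<forall>x>0. 0 \<le> 1 * G n x) \<or> (\<forall>x>0. 0 \<le> (-1) * G n x)" using Gq[of "n - q"] that by simp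
    then show ?thesis
      using eventually_signedI[of 1 0 "G n"] eventually_signedI[of "-1" 0 "G n"] by auto
  qed
  then have Gsg: "eventually_signed (G n)" for n by (rule eventually_signed_all[OF G])
  have Glim: "(G n \<longlongrightarrow> 0) at_top" if "p \<le> n" for n
    using higher_derivs_tendsto_0[OF G tendsto_shift_diff[OF Gp] Gsg, of n] Gp that
    by (cases "n = p") auto
  define E where "E n = G (n + m)" for n
  have E: "deriv_seq E" unfolding E_def by (rule deriv_seq_shift[OF G])
  have Elim: "(E n \<longlongrightarrow> 0) at_top" for n unfolding E_def using m by (intro Glim) simp
  have "\<exists>s. (s = 1 \<or> s = -1) \<and> (\<forall>n. \<forall>x>0. 0 \<le> s * (-1) ^ n * E n x)"
  proof (rule alternating_signs[OF E Elim])
    show "(\<forall>x>0. 0 \<le> E (Suc n) x) \<or> (\<forall>x>0. E (Suc n) x \<le> 0)" for n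
      using Gq[of n] m by (simp add: E_def)
  qed
  then obtain s where s: "s = 1 \<or> s = -1" and Esg: "\<And>n x. 0 < x \<Longrightarrow> 0 \<le> s * (-1) ^ n * E n x" by blast
  obtain S where S: "deriv_seq S" "\<And>n x. 0 < x \<Longrightarrow> S n (x + 1) - S n x = E (Suc n) x"
    "\<And>n x. 0 < x \<Longrightarrow> 0 \<le> s * (-1) ^ n * S n x" "\<And>n. (S n \<longlongrightarrow> 0) at_top"
    by (rule alternating_difference_equation[OF E Esg s Elim]; blast)
  \<comment> \<open>\<open>H 0\<close> solves the equation for g^(q-1); the uncorrected integration
    keeps \<open>S\<close> as its sequence of derivatives.\<close>
  obtain H where H: "deriv_seq H" "\<And>x. 0 < x \<Longrightarrow> H 0 (x + 1) - H 0 x = E 0 x" "\<And>n. H (Suc n) = S n"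
    by (rule difference_equation_lower_base[OF S(1) E S(2) S(4) Elim]; blast)
  have "H 0 (x + 1) - H 0 x = G m x" if "0 < x" for x using H(2)[OF that] by (simp add: E_def)
  from difference_equation_lower[OF G H(1) this] obtain F' where
    F': "deriv_seq F'" "\<And>x. 0 < x \<Longrightarrow> F' 0 (x + 1) - F' 0 x = G 0 x" "\<And>n. F' (Suc n + m) = S n"
    using H(3) by auto
  \<comment> \<open>Subtracting the value at 1 achieves the normalisation at 1 and alters no
    derivative.\<close>
  define F where "F = case_nat (\<lambda>x. F' 0 x - F' 0 1) (\<lambda>n. F' (Suc n))"
  have F: "deriv_seq F"
    unfolding deriv_seq_def
  proof (intro allI impI)
    fix n and x :: real assume "0 < x"
    from deriv_seqD[OF F'(1) this, of n] show "(F n has_real_derivative F (Suc n) x) (at x)"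
      by (cases n) (auto simp: F_def intro!: derivative_eq_intros)
  qed
  have FS: "F (n + q) = S n" for n using F'(3)[of n] by (simp add: F_def m)
  have FG: "F n (x + 1) - F n x = G n x" if "0 < x" for n x
    by (rule difference_equation_derivs[OF F G _ that]) (use F'(2) in \<open>simp add: F_def\<close>)
  have Fsg: "0 \<le> s * (-1) ^ n * F (n + q) x" if "0 < x" for n x using S(3)[OF that] by (simp add: FS)

  define f where "f = restrict (F 0) {0<..}"
  have f: "f x = F 0 x" if "0 < x" for x using that by (simp add: f_def)
  have gD: "g \<in> D_class m" using D_class_of_deriv_tendsto_0[OF G Glim[OF m(2)]] by (simp add: G0)
  \<comment> \<open>Membership in \<open>K_class m\<close> asks for a sign of the derivative of
    order \<open>m + 1 = q\<close>. For \<open>g\<close> this is \<open>E 1\<close>, with sign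
    \<open>- s\<close>; for the solution it is \<open>S 0\<close>, with sign
    \<open>s\<close>.\<close>
  have gK: "g \<in> K_class m"
    using K_class_of_deriv_sign[OF G, of g "- s" m] s Esg[of _ 1] by (auto simp: G0 E_def)
  have fK: "f \<in> K_class m"
    using K_class_of_deriv_sign[OF F f s, of m] Fsg[of _ 0] by (simp add: m)
  have cm: "completely_monotone_on (\<lambda>x. s * (deriv ^^ m) g x) {0<..} \<and>
      completely_monotone_on (\<lambda>x. s * (deriv ^^ q) f x) {0<..}"
  proof
    show "completely_monotone_on (\<lambda>x. s * (deriv ^^ m) g x) {0<..}"
      using Esg by (intro completely_monotone_on_deriv_seq[OF deriv_seq_cmult[OF E, of s]])
        (auto simp: E_def G_def mult_ac)
    show "completely_monotone_on (\<lambda>x. s * (deriv ^^ q) f x) {0<..}"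
      using Fsg by (intro completely_monotone_on_deriv_seq[OF deriv_seq_cmult[OF deriv_seq_shift[OF F, of q], of s]])
        (auto simp: higher_deriv_deriv_seq[OF F f] mult_ac)
  qed
  have "Sigma_fun g = f"
  proof (rule Sigma_fun_eqI[OF gD gK fK])
    show "fdiff f x = g x" if "0 < x" for x
      using FG[OF that, of 0] that by (simp add: fdiff_def f G0)
  qed (simp_all add: f_def F_def)
  moreover have "Sigma_exists g" using gD gK by (auto simp: Sigma_exists_def)
  moreover have "infinitely_differentiable_on f {0<..}"
    by (rule infinitely_differentiable_on_deriv_seq[OF F f])
  moreover have "eventually_tends_monotonically_to_zero ((deriv ^^ n) f)" if n: "p + 1 \<le> n" for n
  proof -
    have "eventually_signed (F k)" if "q \<le> k" for k
    proof -
      have "0 \<le> s * (-1) ^ (k - q) * F k x" if "0 < x" for x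
        using Fsg[OF that, of "k - q"] \<open>q \<le> k\<close> by simp
      moreover have "s * (-1) ^ (k - q) = 1 \<or> s * (-1) ^ (k - q) = -1"
        using s by (auto simp: minus_one_power_iff)
      ultimately show ?thesis by (intro eventually_signedI)
    qed
    then have Fes: "eventually_signed (F k)" for k by (rule eventually_signed_all[OF F])
    \<comment> \<open>At order \<open>p\<close> only the difference of \<open>F p\<close> is known
      to vanish, which is all that the limits from order \<open>p + 1\<close> on require.\<close>
    have "\<forall>\<^sub>F x in at_top. G p x = F p (x + 1) - F p x"
      using eventually_gt_at_top[of 0] by eventually_elim (simp add: FG)
    then have "((\<lambda>x. F p (x + 1) - F p x) \<longlongrightarrow> 0) at_top" using Gp by (rule Lim_transform_eventually[rotated])
    then have "(F n \<longlongrightarrow> 0) at_top" using higher_derivs_tendsto_0[OF F _ Fes] n by simp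
    then have "eventually_tends_monotonically_to_zero (F n)"
      using eventually_signed_monotone[OF F Fes] by (simp add: eventually_tends_monotonically_to_zero_def)
    then show ?thesis
      by (rule eventually_tends_monotonically_to_zero_cong[rotated]) (rule higher_deriv_deriv_seq[OF F f])
  qed
  moreover have "(completely_monotone_on ((deriv ^^ (q - 1)) g) {0<..} \<and>
      completely_monotone_on ((deriv ^^ q) f) {0<..}) \<or>
     (completely_monotone_on (\<lambda>x. - (deriv ^^ (q - 1)) g x) {0<..} \<and>
      completely_monotone_on (\<lambda>x. - (deriv ^^ q) f x) {0<..})"
  proof (cases "s = 1")
    case True
    then show ?thesis using cm m by simp
  next
    case False
    then have "s = -1" using s by simp
    then show ?thesis using cm m by simp
  qed
  moreover have "real_analytic_on f {0<..}"
    by (rule real_analytic_on_of_alternating[OF F s Fsg f])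
  moreover have "admits_newton_series f {0<..} a" if "0 < a" for a
  proof (rule newton_series_of_alternating[OF F f _ _ that])
    \<comment> \<open>The Newton lemma counts signs from order 0, \<open>Fsg\<close> from order
      \<open>q\<close>; the factor \<open>(-1) ^ q\<close> makes up the difference.\<close>
    show "s * (-1) ^ q = 1 \<or> s * (-1) ^ q = -1" using s by (auto simp: minus_one_power_iff)
    show "0 \<le> s * (-1) ^ q * (-1) ^ n * F n x" if "q \<le> n" "0 < x" for n x
    proof -
      have "(-1::real) ^ q * (-1) ^ n = (-1) ^ (n - q)"
        using that(1) by (simp add: minus_one_power_iff)
      then show ?thesis using Fsg[OF that(2), of "n - q"] that(1) by (simp add: mult.assoc)
    qed
  qed
  ultimately show ?thesis by auto
qed

end
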